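(* Under the standing assumptions given in the context (including that $A_n$ has distinct eigenvalues $\lambda_1>\dots>\lambda_n$), let $h\in C^1(\mathbb{R})$ and $Z_n\sim GOE(n)$. Then: 1. The oracle quantities $d_i^{(h)}=\hat w_i^\intercal h(A_n)\hat w_i$, $1\le i\le n$, satisfy, for $\sigma\to0$, $$\lim_{\sigma\to0}\max_{1\le i\le n}\frac{\left|d_i^{(h)}-h(\lambda_i)\right|}{\sigma}=0.$$ 2. Almost surely, $$\lim_{n\to\infty}\lim_{\sigma\to0}\frac{\left\|h(\hat A_n)-h(A_n)\right\|_F^2}{n\sigma^2}=\iint\frac{(h(t)-h(s))^2}{(t-s)^2}\,dH(t)\,dH(s),$$ where the integrand is interpreted as $h'(t)^2$ when $s=t$.
   Context: Standing assumptions. For each $n$, $A_n\in\mathbb{R}^{n\times n}$ is a real symmetric matrix (deterministic or random) with distinct eigenvalues, and for $\sigma>0$, $\hat{A}_n=A_n+\sigma n^{-1/2}Z_n$. (i) As $n\to\infty$, the empirical spectral distribution of the eigenvalues of $A_n$ converges weakly almost surely to a deterministic probability measure $H$. (ii) $H$ is supported on a compact interval of $\mathbb{R}$, and eventually (for all large $n$) all eigenvalues of $A_n$ lie in a compact interval $[h_1,h_2]\subset\mathbb{R}$. (iii) $Z_n$ is independent of $A_n$ and $Z_n\sim GOE(n)$, the Gaussian Orthogonal Ensemble on real symmetric $n\times n$ matrices (independent centered Gaussian entries on and above the diagonal, off-diagonal variance $1$, diagonal variance $2$). Notation. $\hat\lambda_1\ge\dots\ge\hat\lambda_n$ are the eigenvalues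 of $\hat A_n$ and $\hat w_1,\dots,\hat w_n$ corresponding orthonormal eigenvectors (depending on $\sigma$). Functions of symmetric matrices are defined by functional calculus; $\|\cdot\|_F$ is the Frobenius norm. In part 1, $n$ is fixed. *)

theory Defs
  imports "HOL-Probability.Probability" "Jordan_Normal_Form.Char_Poly"
begin

(* Matrices and vectors are those of Jordan_Normal_Form (the dimension n varies); the clashing
   notation of HOL-Analysis is switched off.  Indices run from 0 to n - 1. *)
unbundle no vec_syntax and no inner_syntax

definition symmetric_mat :: "nat \<Rightarrow> real mat \<Rightarrow> bool" where
  "symmetric_mat n A \<longleftrightarrow> A \<in> carrier_mat n n \<and> transpose_mat A = A"

(* Real eigenvalues, with algebraic multiplicity, in decreasing order; for a symmetric n x n
   matrix this list has length n. *)
definition eigvals_desc :: "real mat \<Rightarrow> real list" where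
  "eigvals_desc A = rev (sorted_list_of_multiset (proots (char_poly A)))"

(* An orthonormal system w 0, ..., w (n - 1) in which w i belongs to the i-th largest eigenvalue. *)
definition orthonormal_eigenbasis :: "real mat \<Rightarrow> (nat \<Rightarrow> real vec) \<Rightarrow> bool" where
  "orthonormal_eigenbasis A w \<longleftrightarrow>
     (\<forall>i<dim_row A. eigenvector A (w i) (eigvals_desc A ! i)) \<and>
     (\<forall>i<dim_row A. \<forall>j<dim_row A. w i \<bullet> w j = (if i = j then 1 else 0))"

(* Functional calculus f(A) = sum_i f(lambda_i) w_i w_i^T.  For symmetric A an orthonormal
   eigenbasis exists and the result does not depend on which one is chosen. *)
definition mat_fun :: "(real \<Rightarrow> real) \<Rightarrow> real mat \<Rightarrow> real mat" where
  "mat_fun f A =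
     (let w = (SOME w. orthonormal_eigenbasis A w)
      in mat (dim_row A) (dim_row A)
           (\<lambda>(r, c). \<Sum>i<dim_row A. f (eigvals_desc A ! i) * (w i $ r * w i $ c)))"

definition frobenius_norm :: "real mat \<Rightarrow> real" where
  "frobenius_norm A = sqrt (\<Sum>i<dim_row A. \<Sum>j<dim_col A. (A $$ (i, j))\<^sup>2)"

(* Empirical spectral distribution of an n x n matrix: mass 1/n at each eigenvalue, counted with
   multiplicity (meaningful for n > 0). *)
definition esd :: "nat \<Rightarrow> real mat \<Rightarrow> real measure" where
  "esd n A = distr (uniform_count_measure {..<n}) borel (\<lambda>i. eigvals_desc A ! i)"

(* The n x n real matrices with the Borel sigma-algebra, i.e. the one generated by the entries. *)
definition borel_mat :: "nat \<Rightarrow> real mat measure" where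
  "borel_mat n = vimage_algebra (carrier_mat n n)
     (\<lambda>A. \<lambda>p\<in>{..<n} \<times> {..<n}. A $$ p) (Pi\<^sub>M ({..<n} \<times> {..<n}) (\<lambda>_. borel))"

(* The second argument of normal_density is the standard deviation. *)
definition (in prob_space) GOE :: "nat \<Rightarrow> ('a \<Rightarrow> real mat) \<Rightarrow> bool" where
  "GOE n Z \<longleftrightarrow>
     (\<forall>\<omega>\<in>space M. symmetric_mat n (Z \<omega>)) \<and>
     indep_vars (\<lambda>_. borel) (\<lambda>p \<omega>. Z \<omega> $$ p) {(i, j). i \<le> j \<and> j < n} \<and>
     (\<forall>i j. i \<le> j \<longrightarrow> j < n \<longrightarrow>
        distributed M lborel (\<lambda>\<omega>. Z \<omega> $$ (i, j))
          (normal_density 0 (if i = j then sqrt 2 else 1)))"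

definition perturbed :: "nat \<Rightarrow> real \<Rightarrow> real mat \<Rightarrow> real mat \<Rightarrow> real mat" where
  "perturbed n \<sigma> A Z = A + (\<sigma> / sqrt (real n)) \<cdot>\<^sub>m Z"

end

theory Submission
  imports Defs "Jordan_Normal_Form.Schur_Decomposition"
begin

text \<open>The proof rests on one exact identity. Let \<open>A\<close> and \<open>B\<close> be symmetric, with eigenvalues
\<open>\<lambda>\<^sub>i\<close>, \<open>\<mu>\<^sub>j\<close> and orthonormal eigenvectors \<open>w\<^sub>i\<close>, \<open>v\<^sub>j\<close>. Then
\<open>w\<^sub>i \<bullet> (B - A) v\<^sub>j = (\<mu>\<^sub>j - \<lambda>\<^sub>i) (w\<^sub>i \<bullet> v\<^sub>j)\<close>, and likewise
\<open>w\<^sub>i \<bullet> (h(B) - h(A)) v\<^sub>j = (h(\<mu>\<^sub>j) - h(\<lambda>\<^sub>i)) (w\<^sub>i \<bullet> v\<^sub>j)\<close>. In the mixed pair of bases,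
\<open>h(B) - h(A)\<close> is therefore \<open>B - A\<close> multiplied entrywise by the divided differences of \<open>h\<close>, with no
remainder term (lemma \<open>frobenius_mat_fun_diff\<close>).

Now let \<open>B\<close> be the perturbed matrix. As \<open>\<sigma> \<rightarrow> 0\<close>, Weyl's inequality keeps its eigenvalues close to
those of \<open>A\<close>. Because the latter are distinct, the first identity makes every
overlap \<open>w\<^sub>j \<bullet> v\<^sub>i\<close> with \<open>j \<noteq> i\<close> of order \<open>\<sigma>\<close> (lemma \<open>overlap_small\<close>). Since
\<open>d\<^sub>i - h(\<lambda>\<^sub>i) = \<Sum>\<^sub>j (h(\<lambda>\<^sub>j) - h(\<lambda>\<^sub>i)) (w\<^sub>j \<bullet> v\<^sub>i)\<^sup>2\<close>, the oracle quantities are off by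
\<open>O(\<sigma>\<^sup>2)\<close>, which is the first claim. Since \<open>v\<^sub>j\<close> tends to \<open>w\<^sub>j\<close> up to sign, the same limit
turns the normalised Frobenius distance into
\<open>L\<^sub>n = n\<^sup>-\<^sup>2 \<Sum>\<^sub>i\<^sub>j h[\<lambda>\<^sub>i,\<lambda>\<^sub>j]\<^sup>2 (w\<^sub>i \<bullet> Z w\<^sub>j)\<^sup>2\<close>
(theorem \<open>frobenius_perturbed_tendsto\<close>).

For the limit \<open>n \<rightarrow> \<infinity>\<close>, condition on \<open>A\<^sub>n\<close>, which is independent of \<open>Z\<^sub>n\<close>. The numbers
\<open>w\<^sub>i \<bullet> Z w\<^sub>j\<close> are jointly Gaussian with the covariances of a GOE matrix, so the conditional mean of
\<open>L\<^sub>n\<close> is \<open>n\<^sup>-\<^sup>2 (\<Sum>\<^sub>i\<^sub>j h[\<lambda>\<^sub>i,\<lambda>\<^sub>j]\<^sup>2 + \<Sum>\<^sub>i h'(\<lambda>\<^sub>i)\<^sup>2)\<close>, and Gaussian fourth moments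
bound the conditional variance by a multiple of \<open>n\<^sup>-\<^sup>2\<close> while the spectrum stays in a fixed interval
(lemma \<open>limit_form_variance\<close>). This is summable, so the deviations tend to 0 almost surely,
however the matrices of different sizes depend on each other. The means converge because the double
sum integrates a continuous bounded kernel against two copies of the spectral distribution, while
the sum over the diagonal contributes \<open>O(1/n)\<close> (lemma \<open>limit_mean_tendsto\<close>).

Conditioning requires \<open>L\<^sub>n\<close> to be a measurable function of the pair \<open>(A\<^sub>n, Z\<^sub>n)\<close>, although its
formula involves arbitrarily chosen eigenvectors. It is the pointwise limit of expressions in
\<open>h(A)\<close> and \<open>h\<close> of the perturbation, and \<open>h(A)\<close> is itself a limit of polynomials in \<open>A\<close>.\<close>

section \<open>The spectral theorem for real symmetric matrices\<close>

lemma symmetric_matD: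
  assumes "symmetric_mat n A"
  shows "A \<in> carrier_mat n n" "transpose_mat A = A" "dim_row A = n" "dim_col A = n"
  using assms by (auto simp: symmetric_mat_def)

lemma symmetric_mat_scalar_prod:
  assumes "symmetric_mat n A" "x \<in> carrier_vec n" "y \<in> carrier_vec n"
  shows "(A *\<^sub>v x) \<bullet> y = x \<bullet> (A *\<^sub>v y)"
  using transpose_vec_mult_scalar[OF symmetric_matD(1)[OF assms(1)] assms(3,2)]
  by (simp add: symmetric_matD(2)[OF assms(1)])

text \<open>Over the complex numbers the characteristic polynomial splits. If \<open>A v = a v\<close>, then \<open>a\<close> and its
conjugate both arise from moving \<open>A\<close> across the Hermitian product of \<open>v\<close> with itself, so every root
is real and the factorisation descends to the real numbers.\<close>

lemma symmetric_char_poly_splits: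
  assumes A: "symmetric_mat n A"
  shows "\<exists>es. char_poly A = (\<Prod>e\<leftarrow>es. [:- e, 1:]) \<and> length es = n"
proof -
  define C :: "complex mat" where "C = map_mat complex_of_real A"
  have AC: "A \<in> carrier_mat n n" using symmetric_matD[OF A] by simp
  have C: "C \<in> carrier_mat n n" using AC by (simp add: C_def)
  have CT: "transpose_mat C = C"
  proof -
    have "transpose_mat C = map_mat complex_of_real (transpose_mat A)"
      using AC by (intro eq_matI) (auto simp: C_def)
    then show ?thesis using symmetric_matD(2)[OF A] by (simp add: C_def)
  qed
  obtain as where as: "char_poly C = (\<Prod>a\<leftarrow>as. [:- a, 1:])" "length as = n"
    using char_poly_factorized[OF C] by blast
  have real_root: "a = complex_of_real (Re a)" if "a \<in> set as" for a
  proof -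
    have "poly (char_poly C) a = 0"
      using that unfolding as(1) by (auto simp: poly_prod_list prod_list_zero_iff o_def)
    then obtain v where v: "v \<in> carrier_vec n" "v \<noteq> 0\<^sub>v n" "C *\<^sub>v v = a \<cdot>\<^sub>v v"
      using eigenvalue_root_char_poly[OF C] C by (auto simp: eigenvalue_def eigenvector_def)
    have cv: "conjugate v \<in> carrier_vec n" using v(1) by simp
    have Ccv: "C *\<^sub>v conjugate v = cnj a \<cdot>\<^sub>v conjugate v"
    proof -
      have "C *\<^sub>v conjugate v = conjugate (C *\<^sub>v v)"
      proof (rule eq_vecI)
        fix i assume i: "i < dim_vec (conjugate (C *\<^sub>v v))"
        then have i: "i < n" using C by simp
        have "(C *\<^sub>v conjugate v) $ i = (\<Sum>j<n. C $$ (i,j) * cnj (v $ j))"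
          using i C v(1) by (simp add: scalar_prod_def atLeast0LessThan)
        also have "\<dots> = cnj (\<Sum>j<n. C $$ (i,j) * v $ j)"
          using i AC by (simp add: C_def)
        also have "\<dots> = conjugate (C *\<^sub>v v) $ i"
          using i C v(1) by (simp add: scalar_prod_def atLeast0LessThan)
        finally show "(C *\<^sub>v conjugate v) $ i = conjugate (C *\<^sub>v v) $ i" .
      qed (use C in simp)
      then show ?thesis using v by (simp add: conjugate_smult_vec)
    qed
    have "a * (v \<bullet>c v) = (C *\<^sub>v v) \<bullet>c v" using v cv by simp
    also have "\<dots> = v \<bullet> (C *\<^sub>v conjugate v)"
      using transpose_vec_mult_scalar[OF C cv v(1)] CT by simp
    also have "\<dots> = cnj a * (v \<bullet>c v)" using v cv by (simp add: Ccv)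
    finally have "a = cnj a"
      using conjugate_square_eq_0_vec[OF v(1)] v(2) by auto
    then show ?thesis by (metis Reals_cnj_iff of_real_Re)
  qed
  define es where "es = map Re as"
  have CA: "char_poly C = map_poly complex_of_real (char_poly A)"
    unfolding C_def by (rule of_real_hom.char_poly_hom[OF AC])
  have "as = map complex_of_real es"
    using real_root by (auto simp: es_def o_def intro!: map_idI[symmetric])
  then have "map_poly complex_of_real (char_poly A) = (\<Prod>a\<leftarrow>map complex_of_real es. [:- a, 1:])"
    using as(1) CA by simp
  also have "\<dots> = map_poly complex_of_real (\<Prod>e\<leftarrow>es. [:- e, 1:])"
  proof -
    interpret P: map_poly_comm_ring_hom complex_of_real ..
    show ?thesis
      by (induction es) (simp_all add: P.hom_mult del: mult_pCons_left mult_pCons_right)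
  qed
  finally have "char_poly A = (\<Prod>e\<leftarrow>es. [:- e, 1:])"
    by (simp add: poly_eq_iff coeff_map_poly)
  then show ?thesis using as(2) by (intro exI[of _ es]) (simp add: es_def)
qed

text \<open>The first step of deflation: a vector is completed to a basis, the Gram-Schmidt process leaves it
in first place, and the resulting orthogonal columns are normalised.\<close>

lemma orthogonal_mat_with_first_col:
  fixes v :: "real vec"
  assumes v: "v \<in> carrier_vec n" and v0: "v \<noteq> 0\<^sub>v n"
  shows "\<exists>W\<in>carrier_mat n n. transpose_mat W * W = 1\<^sub>m n \<and> (\<exists>c. col W 0 = c \<cdot>\<^sub>v v)"
proof -
  interpret cof_vec_space n "TYPE(real)" .
  have n: "0 < n" using v v0 by (cases n) auto
  have conj[simp]: "conjugate u = u" for u :: "real vec" by (rule eq_vecI) auto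
  define b where "b = basis_completion v"
  define ws where "ws = gram_schmidt n b"
  note bb = basis_completion[OF v v0, folded b_def]
  note gs = gram_schmidt_result[OF bb(2) bb(4) bb(5) ws_def]
  have len: "length ws = n" using gs bb by simp
  have "hd ws = v" using bb(6,7) n v unfolding ws_def by (cases b) auto
  then have ws0: "ws ! 0 = v" using len n by (metis hd_conv_nth list.size(3) less_irrefl)
  have wsc: "ws ! i \<in> carrier_vec n" if "i < n" for i using gs(3) len that by auto
  have orth: "ws ! i \<bullet> ws ! j = 0 \<longleftrightarrow> i \<noteq> j" if "i < n" "j < n" for i j
    using gs(2) len that unfolding corthogonal_def by auto
  have pos: "ws ! i \<bullet> ws ! i > 0" if "i < n" for i
    using orth[OF that that] conjugate_square_greater_0_vec[OF wsc[OF that]] 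
    by (metis conj conjugate_square_ge_0_vec wsc that order_le_less)
  define W where "W = mat n n (\<lambda>(i,j). ws ! j $ i / sqrt (ws ! j \<bullet> ws ! j))"
  have W: "W \<in> carrier_mat n n" by (simp add: W_def)
  have colW: "col W j = (1 / sqrt (ws ! j \<bullet> ws ! j)) \<cdot>\<^sub>v ws ! j" if "j < n" for j
    using that wsc[OF that] by (intro eq_vecI) (auto simp: W_def)
  have "transpose_mat W * W = 1\<^sub>m n"
  proof (rule eq_matI)
    fix i j assume "i < dim_row (1\<^sub>m n)" "j < dim_col (1\<^sub>m n)"
    then have ij: "i < n" "j < n" by auto
    have "(transpose_mat W * W) $$ (i,j) = col W i \<bullet> col W j" using ij W by simp
    also have "\<dots> = (ws ! i \<bullet> ws ! j) / (sqrt (ws ! i \<bullet> ws ! i) * sqrt (ws ! j \<bullet> ws ! j))"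
      using ij wsc[OF ij(1)] wsc[OF ij(2)]
      by (simp add: colW smult_scalar_prod_distrib[of _ n] scalar_prod_smult_distrib[of _ n])
    also have "\<dots> = 1\<^sub>m n $$ (i,j)"
      using ij orth[OF ij] pos[OF ij(1)] by (cases "i = j") auto
    finally show "(transpose_mat W * W) $$ (i,j) = 1\<^sub>m n $$ (i,j)" .
  qed (use W in auto)
  then show ?thesis using W colW[OF n] ws0 by auto
qed

text \<open>Induction on the list of eigenvalues. Conjugating by an orthogonal matrix \<open>W\<close> whose first column is
an eigenvector for \<open>e\<close> produces a symmetric matrix with first column \<open>(e, 0, \<dots>, 0)\<close>, hence also with
that first row; what remains is a symmetric block of size \<open>n - 1\<close> whose characteristic polynomial has
the remaining factors. Prescribing the list of eigenvalues fixes the order of the diagonal, so no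
sorting is needed afterwards.\<close>

lemma orthogonal_diagonalisation:
  assumes "symmetric_mat n A" and "char_poly A = (\<Prod>e\<leftarrow>es. [:- e, 1:])"
  shows "\<exists>U\<in>carrier_mat n n. transpose_mat U * U = 1\<^sub>m n \<and>
           transpose_mat U * A * U = mat n n (\<lambda>(i,j). if i = j then es ! i else 0)"
  using assms
proof (induction es arbitrary: n A)
  case Nil
  have "n = 0" using degree_monic_char_poly[OF symmetric_matD(1)[OF Nil(1)]] Nil(2) by simp
  then show ?case using symmetric_matD(1)[OF Nil(1)] by (intro bexI[of _ "1\<^sub>m 0"]) auto
next
  case (Cons e es n A)
  have A: "A \<in> carrier_mat n n" using Cons(2) symmetric_matD by auto
  have mon: "monic (\<Prod>e\<leftarrow> es. [:- e, 1:])" by (rule monic_prod_list, auto)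
  then have "degree (char_poly A) = Suc (degree (\<Prod>e\<leftarrow>es. [:- e, 1:]))"
    unfolding Cons(3) list.map prod_list.Cons by (subst degree_mult_eq) auto
  then have n: "n > 0" using degree_monic_char_poly[OF A] by auto
  define m where "m = n - 1"
  have nm: "n = 1 + m" using n by (simp add: m_def)
  have "eigenvalue A e" unfolding eigenvalue_root_char_poly[OF A] Cons(3) by simp
  then obtain v where v: "v \<in> carrier_vec n" "v \<noteq> 0\<^sub>v n" "A *\<^sub>v v = e \<cdot>\<^sub>v v"
    using A by (auto simp: eigenvalue_def eigenvector_def)
  obtain W c where W: "W \<in> carrier_mat n n" "transpose_mat W * W = 1\<^sub>m n" "col W 0 = c \<cdot>\<^sub>v v"
    using orthogonal_mat_with_first_col[OF v(1,2)] by blast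
  have WT: "transpose_mat W \<in> carrier_mat n n" using W(1) by simp
  have WW: "W * transpose_mat W = 1\<^sub>m n" using mat_mult_left_right_inverse[OF WT W(1) W(2)] .
  define B where "B = transpose_mat W * A * W"
  have B: "B \<in> carrier_mat n n" using W A by (simp add: B_def)
  have BT: "transpose_mat B = B"
    using A W(1) WT symmetric_matD(2)[OF Cons(2)]
    by (simp add: B_def transpose_mult[of _ n n _ n] assoc_mult_mat[of _ n n _ n _ n])
  have "A *\<^sub>v col W 0 = e \<cdot>\<^sub>v col W 0"
    using v A by (simp add: W(3) mult_mat_vec[OF A] smult_smult_assoc mult.commute)
  then have AW0: "col (A * W) 0 = e \<cdot>\<^sub>v col W 0" using col_mult2[OF A W(1) n] by simp
  have B0: "B $$ (i, 0) = (if i = 0 then e else 0)" if "i < n" for i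
  proof -
    have "B $$ (i,0) = (transpose_mat W * (A * W)) $$ (i,0)"
      using A W(1) WT by (simp add: B_def assoc_mult_mat[of _ n n _ n _ n])
    also have "\<dots> = col W i \<bullet> col (A * W) 0" using that n W A by simp
    also have "\<dots> = e * (transpose_mat W * W) $$ (i,0)"
      using that n W(1) unfolding AW0 by simp
    finally show ?thesis using that n unfolding W(2) by simp
  qed
  have B0': "B $$ (0, i) = (if i = 0 then e else 0)" if "i < n" for i
    using B0[OF that] BT B that n by (metis index_transpose_mat(1) carrier_matD)
  obtain A1 A2 A0 A3 where split: "split_block B 1 1 = (A1,A2,A0,A3)"
    by (cases "split_block B 1 1") auto
  have dims: "dim_row B = 1 + m" "dim_col B = 1 + m" using B nm by auto
  note sb = split_block[OF split dims]
  have A1: "A1 = mat 1 1 (\<lambda>_. e)" and A2: "A2 = 0\<^sub>m 1 m" and A0: "A0 = 0\<^sub>m m 1"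
    using split[unfolded split_block_def Let_def] B0 B0' n nm B by auto
  have A3c: "A3 \<in> carrier_mat m m" using sb by simp
  have "transpose_mat A3 = A3"
  proof -
    have "A3 $$ (j,i) = A3 $$ (i,j)" if "i < m" "j < m" for i j
    proof -
      have 3: "A3 $$ (i,j) = B $$ (Suc i, Suc j)" if "i < m" "j < m" for i j
        using split[unfolded split_block_def Let_def] that dims by auto
      show ?thesis using that 3 BT dims by (metis Suc_less_eq index_transpose_mat(1) plus_1_eq_Suc)
    qed
    then show ?thesis using A3c by (intro eq_matI) auto
  qed
  then have A3s: "symmetric_mat m A3" using A3c by (simp add: symmetric_mat_def)
  have "similar_mat_wit B A (transpose_mat W) W"
    by (rule similar_mat_witI[of _ _ n]) (use W WT WW A B in \<open>auto simp: B_def\<close>)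
  then have "char_poly B = char_poly A" using char_poly_similar by (auto simp: similar_mat_def)
  moreover have "char_poly B = char_poly A1 * char_poly A3"
    using char_poly_four_block_zeros_col[of A1 A2 m A3] sb A0 by metis
  moreover have "char_poly A1 = [: -e,1 :]"
    by (simp add: A1 char_poly_defs det_def sign_def)
  ultimately have "[:-e,1:] * char_poly A3 = [:-e,1:] * (\<Prod>e\<leftarrow>es. [:- e, 1:])"
    using Cons(3) by simp
  then have "char_poly A3 = (\<Prod>e\<leftarrow>es. [:- e, 1:])"
    by (metis mult_cancel_left pCons_eq_0_iff zero_neq_one)
  from Cons.IH[OF A3s this] obtain V where V: "V \<in> carrier_mat m m" "transpose_mat V * V = 1\<^sub>m m"
    "transpose_mat V * A3 * V = mat m m (\<lambda>(i,j). if i = j then es ! i else 0)" by blast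
  define P where "P = four_block_mat (1\<^sub>m 1) (0\<^sub>m 1 m) (0\<^sub>m m 1) V"
  have P: "P \<in> carrier_mat n n" using V unfolding P_def nm by (intro four_block_carrier_mat) auto
  have PT: "transpose_mat P = four_block_mat (1\<^sub>m 1) (0\<^sub>m 1 m) (0\<^sub>m m 1) (transpose_mat V)"
    unfolding P_def using V by (subst transpose_four_block_mat[of _ 1 1 _ m _ m]) auto
  have PTc: "transpose_mat P \<in> carrier_mat n n" using P by simp
  have VT: "transpose_mat V \<in> carrier_mat m m" using V by simp
  have PP: "transpose_mat P * P = 1\<^sub>m n"
    unfolding PT unfolding P_def nm using V VT
    by (subst mult_four_block_mat[of _ 1 1 _ m _ m _ _ 1 _ m])
       (auto intro!: eq_matI simp: V(2) four_block_mat_def)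
  have BP: "transpose_mat P * B * P = four_block_mat A1 (0\<^sub>m 1 m) (0\<^sub>m m 1) (transpose_mat V * A3 * V)"
    unfolding PT unfolding P_def sb(5) A2 A0 using V VT A3c sb(1)
    by (simp add: mult_four_block_mat[of _ 1 1 _ m _ m _ _ 1 _ m] A1)
  have BP': "transpose_mat P * B * P = mat n n (\<lambda>(i,j). if i = j then (e # es) ! i else 0)"
    unfolding BP V(3) A1 nm by (rule eq_matI) (auto simp: four_block_mat_def nth_Cons')
  have "transpose_mat (W * P) * (W * P) = transpose_mat P * ((transpose_mat W * W) * P)"
    using W(1) WT P PTc by (simp add: transpose_mult[of _ n n _ n] assoc_mult_mat[of _ n n _ n _ n])
  then have 1: "transpose_mat (W * P) * (W * P) = 1\<^sub>m n" using W(2) P PP by simp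
  have 2: "transpose_mat (W * P) * A * (W * P) = transpose_mat P * B * P"
    unfolding B_def using W(1) WT P PTc A
    by (simp add: transpose_mult[of _ n n _ n] assoc_mult_mat[of _ n n _ n _ n])
  show ?case
    using 1 2 BP' W(1) P by (intro bexI[of _ "W * P"]) auto
qed

lemma char_poly_eigvals_desc:
  assumes "symmetric_mat n A"
  shows "char_poly A = (\<Prod>e\<leftarrow>eigvals_desc A. [:- e, 1:])" and "length (eigvals_desc A) = n"
proof -
  obtain es where es: "char_poly A = (\<Prod>e\<leftarrow>es. [:- e, 1:])" "length es = n"
    using symmetric_char_poly_splits[OF assms] by blast
  have "proots (\<Prod>e\<leftarrow>es. [:- e, 1:]) = mset es"
  proof (induction es)
    case (Cons e es)
    have "(\<Prod>e\<leftarrow>es. [:- e, 1:]) \<noteq> 0" by (auto simp: prod_list_zero_iff)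
    then show ?case using Cons proots_mult[of "[:-e,1:]" "(\<Prod>e\<leftarrow>es. [:- e, 1:])"]
      by (simp del: mult_pCons_left mult_pCons_right)
  qed simp
  then have ms: "mset (eigvals_desc A) = mset es" by (simp add: eigvals_desc_def es)
  then have "mset (map (\<lambda>e. [:- e, 1:]) (eigvals_desc A)) = mset (map (\<lambda>e. [:- e, 1:]) es)"
    by (metis mset_map)
  then show "char_poly A = (\<Prod>e\<leftarrow>eigvals_desc A. [:- e, 1:])"
    unfolding es(1) by (metis prod_mset_prod_list)
  show "length (eigvals_desc A) = n" using ms es(2) by (metis size_mset)
qed

lemma eigvals_desc_antimono:
  assumes "i \<le> j" "j < length (eigvals_desc A)"
  shows "eigvals_desc A ! j \<le> eigvals_desc A ! i"
proof -
  have "sorted (rev (eigvals_desc A))" by (simp add: eigvals_desc_def)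
  then show ?thesis using assms by (simp add: sorted_rev_nth_mono)
qed

theorem orthonormal_eigenbasis_exists:
  assumes "symmetric_mat n A"
  shows "\<exists>w. orthonormal_eigenbasis A w"
proof -
  note c = char_poly_eigvals_desc[OF assms]
  have A: "A \<in> carrier_mat n n" using assms symmetric_matD by auto
  define D where "D = mat n n (\<lambda>(i,j). if i = j then eigvals_desc A ! i else 0)"
  obtain U where U: "U \<in> carrier_mat n n" "transpose_mat U * U = 1\<^sub>m n"
    "transpose_mat U * A * U = D"
    using orthogonal_diagonalisation[OF assms c(1)] unfolding D_def by blast
  have UT: "transpose_mat U \<in> carrier_mat n n" using U by simp
  have UU: "U * transpose_mat U = 1\<^sub>m n" using mat_mult_left_right_inverse[OF UT U(1) U(2)] .
  have "A * U = (U * transpose_mat U) * (A * U)" using UU A U by simp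
  also have "\<dots> = U * D"
    unfolding U(3)[symmetric] using U(1) UT A by (simp add: assoc_mult_mat[of _ n n _ n _ n])
  finally have AU: "A * U = U * D" .
  have orth: "col U i \<bullet> col U j = (if i = j then 1 else 0)" if "i < n" "j < n" for i j
  proof -
    have "col U i \<bullet> col U j = (transpose_mat U * U) $$ (i,j)" using that U(1) by simp
    then show ?thesis using that unfolding U(2) by simp
  qed
  have "eigenvector A (col U i) (eigvals_desc A ! i)" if i: "i < n" for i
  proof -
    have "A *\<^sub>v col U i = col (U * D) i" using col_mult2[OF A U(1) i] AU by simp
    also have "\<dots> = eigvals_desc A ! i \<cdot>\<^sub>v col U i"
    proof (rule eq_vecI)
      fix j assume "j < dim_vec (eigvals_desc A ! i \<cdot>\<^sub>v col U i)"
      then have j: "j < n" using U by simp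
      have "col (U * D) i $ j = (\<Sum>k<n. U $$ (j,k) * (if k = i then eigvals_desc A ! k else 0))"
        using i j U(1) by (simp add: D_def scalar_prod_def atLeast0LessThan cong: if_cong)
      also have "\<dots> = U $$ (j,i) * eigvals_desc A ! i"
        using i by (subst sum.remove[of _ i]) auto
      finally show "col (U * D) i $ j = (eigvals_desc A ! i \<cdot>\<^sub>v col U i) $ j"
        using i j U by simp
    qed (use U in \<open>simp add: D_def\<close>)
    finally have "A *\<^sub>v col U i = eigvals_desc A ! i \<cdot>\<^sub>v col U i" .
    moreover have "col U i \<noteq> 0\<^sub>v n" using orth[OF i i] U(1) by auto
    moreover have "col U i \<in> carrier_vec n" using U(1) by (intro carrier_vecI) simp
    ultimately show ?thesis using A by (simp add: eigenvector_def)
  qed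
  then show ?thesis using orth A by (intro exI[of _ "col U"]) (auto simp: orthonormal_eigenbasis_def)
qed

section \<open>Orthonormal bases and the functional calculus\<close>

definition orthonormal_basis :: "nat \<Rightarrow> (nat \<Rightarrow> real vec) \<Rightarrow> bool" where
  "orthonormal_basis n w \<longleftrightarrow>
     (\<forall>i<n. w i \<in> carrier_vec n) \<and> (\<forall>i<n. \<forall>j<n. w i \<bullet> w j = (if i = j then 1 else 0))"

text \<open>This is the choice of eigenvectors made in the functional calculus, so that statements about
\<open>eigbasis A\<close> are statements about \<open>mat_fun f A\<close>.\<close>

definition eigbasis :: "real mat \<Rightarrow> nat \<Rightarrow> real vec" where
  "eigbasis A = (SOME w. orthonormal_eigenbasis A w)"

lemma orthonormal_basisD:
  assumes "orthonormal_basis n w" "i < n"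
  shows "w i \<in> carrier_vec n" "dim_vec (w i) = n" "w i \<bullet> w i = 1"
    "\<And>j. j < n \<Longrightarrow> w i \<bullet> w j = (if i = j then 1 else 0)"
  using assms by (auto simp: orthonormal_basis_def)

lemma scalar_prod_lessThan:
  "dim_vec y = n \<Longrightarrow> x \<bullet> y = (\<Sum>i<n. x $ i * y $ i)"
  by (simp add: scalar_prod_def atLeast0LessThan)

lemma mult_mat_vec_lessThan:
  "A \<in> carrier_mat n m \<Longrightarrow> x \<in> carrier_vec m \<Longrightarrow> i < n \<Longrightarrow> (A *\<^sub>v x) $ i = (\<Sum>j<m. A $$ (i,j) * x $ j)"
  by (simp add: scalar_prod_lessThan)

lemma eigenbasis_orthonormal:
  assumes "symmetric_mat n A" "orthonormal_eigenbasis A w"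
  shows "orthonormal_basis n w" and "i < n \<Longrightarrow> A *\<^sub>v w i = eigvals_desc A ! i \<cdot>\<^sub>v w i"
  using assms symmetric_matD[OF assms(1)]
  by (auto simp: orthonormal_eigenbasis_def orthonormal_basis_def eigenvector_def)

lemma eigbasis: "symmetric_mat n A \<Longrightarrow> orthonormal_eigenbasis A (eigbasis A)"
  using orthonormal_eigenbasis_exists someI_ex unfolding eigbasis_def by metis

lemma eigbasis_orthonormal: "symmetric_mat n A \<Longrightarrow> orthonormal_basis n (eigbasis A)"
  using eigbasis eigenbasis_orthonormal(1) by blast

text \<open>The rows of the matrix \<open>W\<close> of a basis satisfy \<open>W W\<^sup>T = 1\<close>; the assertion is \<open>W\<^sup>T W = 1\<close>, which follows
because a one-sided inverse of a square matrix is two-sided.\<close>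

lemma orthonormal_basis_complete:
  assumes w: "orthonormal_basis n w" and "r < n" "c < n"
  shows "(\<Sum>i<n. w i $ r * w i $ c) = (if r = c then 1 else 0)"
proof -
  define W where "W = mat n n (\<lambda>(i,j). w i $ j)"
  have W: "W \<in> carrier_mat n n" by (simp add: W_def)
  have WT: "transpose_mat W \<in> carrier_mat n n" using W by simp
  have "W * transpose_mat W = 1\<^sub>m n"
  proof (rule eq_matI)
    fix i j assume "i < dim_row (1\<^sub>m n)" "j < dim_col (1\<^sub>m n)"
    then have ij: "i < n" "j < n" by auto
    have "(W * transpose_mat W) $$ (i,j) = (\<Sum>k<n. w i $ k * w j $ k)"
      using ij by (simp add: W_def scalar_prod_def atLeast0LessThan)
    also have "\<dots> = w i \<bullet> w j"
      using orthonormal_basisD[OF w ij(2)] by (simp add: scalar_prod_lessThan)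
    finally show "(W * transpose_mat W) $$ (i,j) = 1\<^sub>m n $$ (i,j)"
      using orthonormal_basisD[OF w ij(1)] ij by simp
  qed (use W in auto)
  then have "transpose_mat W * W = 1\<^sub>m n" using mat_mult_left_right_inverse[OF W WT] by simp
  then have "(transpose_mat W * W) $$ (r,c) = 1\<^sub>m n $$ (r,c)" by simp
  then show ?thesis using assms(2,3) by (simp add: W_def scalar_prod_def atLeast0LessThan)
qed

lemma parseval:
  assumes w: "orthonormal_basis n w" and x: "x \<in> carrier_vec n" and y: "y \<in> carrier_vec n"
  shows "(\<Sum>i<n. (w i \<bullet> x) * (w i \<bullet> y)) = x \<bullet> y"
proof -
  have "(\<Sum>i<n. (w i \<bullet> x) * (w i \<bullet> y)) = (\<Sum>i<n. \<Sum>r<n. \<Sum>c<n. x $ r * y $ c * (w i $ r * w i $ c))"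
    using x y by (simp add: scalar_prod_lessThan[where n=n] sum_product mult_ac)
  also have "\<dots> = (\<Sum>r<n. \<Sum>c<n. \<Sum>i<n. x $ r * y $ c * (w i $ r * w i $ c))"
    by (subst sum.swap, rule sum.cong[OF refl], rule sum.swap)
  also have "\<dots> = (\<Sum>r<n. \<Sum>c<n. x $ r * y $ c * (if r = c then 1 else 0))"
    by (simp only: sum_distrib_left[symmetric])
       (intro sum.cong refl arg_cong2[where f="(*)"], use orthonormal_basis_complete[OF w] in auto)
  also have "\<dots> = x \<bullet> y"
    using y by (simp add: scalar_prod_lessThan[where n=n] if_distrib cong: if_cong)
  finally show ?thesis .
qed

lemma parseval_norm:
  assumes "orthonormal_basis n w" "x \<in> carrier_vec n"
  shows "(\<Sum>i<n. (w i \<bullet> x)\<^sup>2) = x \<bullet> x"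
  using parseval[OF assms assms(2)] by (simp add: power2_eq_square)

lemma mat_fun_carrier: "symmetric_mat n A \<Longrightarrow> mat_fun f A \<in> carrier_mat n n"
  using symmetric_matD by (auto simp: mat_fun_def Let_def)

lemma mat_fun_entry:
  "symmetric_mat n A \<Longrightarrow> r < n \<Longrightarrow> c < n \<Longrightarrow>
   mat_fun f A $$ (r,c) = (\<Sum>i<n. f (eigvals_desc A ! i) * (eigbasis A i $ r * eigbasis A i $ c))"
  using symmetric_matD(3)[of n A] by (simp add: mat_fun_def eigbasis_def Let_def)

lemma mat_fun_symmetric: "symmetric_mat n A \<Longrightarrow> symmetric_mat n (mat_fun f A)"
  using mat_fun_carrier[of n A f]
  by (auto simp: symmetric_mat_def[of n "mat_fun f A"] mat_fun_entry mult.commute intro!: eq_matI)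

lemma mat_fun_eigvec:
  assumes A: "symmetric_mat n A" and i: "i < n"
  shows "mat_fun f A *\<^sub>v eigbasis A i = f (eigvals_desc A ! i) \<cdot>\<^sub>v eigbasis A i"
proof (rule eq_vecI)
  let ?w = "eigbasis A"
  note w = eigbasis_orthonormal[OF A]
  note wi = orthonormal_basisD[OF w i]
  fix r assume "r < dim_vec (f (eigvals_desc A ! i) \<cdot>\<^sub>v ?w i)"
  then have r: "r < n" using wi by simp
  have "(mat_fun f A *\<^sub>v ?w i) $ r =
      (\<Sum>c<n. \<Sum>k<n. f (eigvals_desc A ! k) * ?w k $ r * (?w k $ c * ?w i $ c))"
    using mult_mat_vec_lessThan[OF mat_fun_carrier[OF A] wi(1) r] r
    by (simp add: mat_fun_entry[OF A] sum_distrib_right mult.assoc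
        del: index_mult_mat_vec)
  also have "\<dots> = (\<Sum>k<n. f (eigvals_desc A ! k) * ?w k $ r * (?w k \<bullet> ?w i))"
    by (subst sum.swap) (simp add: sum_distrib_left scalar_prod_lessThan[OF wi(2)])
  also have "\<dots> = (\<Sum>k<n. if k = i then f (eigvals_desc A ! k) * ?w k $ r else 0)"
    using orthonormal_basisD(4)[OF w _ i] by (intro sum.cong) auto
  finally show "(mat_fun f A *\<^sub>v ?w i) $ r = (f (eigvals_desc A ! i) \<cdot>\<^sub>v ?w i) $ r"
    using i r wi by simp
qed (use mat_fun_carrier[OF A, of f] orthonormal_basisD[OF eigbasis_orthonormal[OF A] i] in simp)

lemma eigvec_scalar_prod:
  assumes "symmetric_mat n B" "u \<in> carrier_vec n" "x \<in> carrier_vec n" "B *\<^sub>v u = l \<cdot>\<^sub>v u"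
  shows "u \<bullet> (B *\<^sub>v x) = l * (u \<bullet> x)"
  using symmetric_mat_scalar_prod[OF assms(1-3)] assms by simp

lemma quadratic_form_eigenbasis:
  assumes B: "symmetric_mat n B" and w: "orthonormal_basis n w" and x: "x \<in> carrier_vec n"
    and ev: "\<And>i. i < n \<Longrightarrow> B *\<^sub>v w i = l i \<cdot>\<^sub>v w i"
  shows "x \<bullet> (B *\<^sub>v x) = (\<Sum>i<n. l i * (w i \<bullet> x)\<^sup>2)"
proof -
  have "x \<bullet> (B *\<^sub>v x) = (\<Sum>i<n. (w i \<bullet> x) * (w i \<bullet> (B *\<^sub>v x)))"
    using parseval[OF w x, of "B *\<^sub>v x"] symmetric_matD[OF B] x by simp
  also have "\<dots> = (\<Sum>i<n. l i * (w i \<bullet> x)\<^sup>2)"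
    using eigvec_scalar_prod[OF B orthonormal_basisD(1)[OF w] x ev]
    by (intro sum.cong) (auto simp: power2_eq_square)
  finally show ?thesis .
qed

text \<open>The Frobenius norm may be computed in two different orthonormal bases, one on each side. For
\<open>h(B) - h(A)\<close> the useful choice is an eigenbasis of \<open>A\<close> on the left and one of \<open>B\<close> on the right.\<close>

lemma frobenius_norm_bases:
  assumes w: "orthonormal_basis n w" and v: "orthonormal_basis n v" and B: "B \<in> carrier_mat n n"
  shows "(frobenius_norm B)\<^sup>2 = (\<Sum>i<n. \<Sum>j<n. (w i \<bullet> (B *\<^sub>v v j))\<^sup>2)"
proof -
  have "(\<Sum>i<n. \<Sum>j<n. (w i \<bullet> (B *\<^sub>v v j))\<^sup>2) = (\<Sum>j<n. \<Sum>i<n. (w i \<bullet> (B *\<^sub>v v j))\<^sup>2)"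
    by (rule sum.swap)
  also have "\<dots> = (\<Sum>j<n. (B *\<^sub>v v j) \<bullet> (B *\<^sub>v v j))"
    using parseval_norm[OF w] B orthonormal_basisD(1)[OF v] by (intro sum.cong) auto
  also have "\<dots> = (\<Sum>j<n. \<Sum>r<n. (v j \<bullet> row B r)\<^sup>2)"
    using B orthonormal_basisD(1)[OF v]
    by (intro sum.cong)
       (auto simp: scalar_prod_lessThan[of "B *\<^sub>v _" n] power2_eq_square comm_scalar_prod[of _ n])
  also have "\<dots> = (\<Sum>r<n. \<Sum>j<n. (v j \<bullet> row B r)\<^sup>2)" by (rule sum.swap)
  also have "\<dots> = (\<Sum>r<n. row B r \<bullet> row B r)"
    using parseval_norm[OF v] B by (intro sum.cong) auto
  also have "\<dots> = (frobenius_norm B)\<^sup>2"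
    using B by (simp add: frobenius_norm_def sum_nonneg scalar_prod_lessThan[where n=n] power2_eq_square)
  finally show ?thesis by simp
qed

definition divdiff :: "(real \<Rightarrow> real) \<Rightarrow> real \<Rightarrow> real \<Rightarrow> real" where
  "divdiff h s t = (if s = t then deriv h t else (h t - h s) / (t - s))"

lemma divdiff_mult: "divdiff h s t * (t - s) = h t - h s"
  by (simp add: divdiff_def)

text \<open>The exact identity behind the theorem. If \<open>\<lambda>\<^sub>i = \<mu>\<^sub>j\<close>, both \<open>w\<^sub>i \<bullet> (B - A) v\<^sub>j\<close> and
\<open>w\<^sub>i \<bullet> (h(B) - h(A)) v\<^sub>j\<close> vanish, so the identity holds for repeated values as well.\<close>

lemma frobenius_mat_fun_diff:
  assumes A: "symmetric_mat n A" and B: "symmetric_mat n B"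
  shows "(frobenius_norm (mat_fun h B - mat_fun h A))\<^sup>2 =
    (\<Sum>i<n. \<Sum>j<n. (divdiff h (eigvals_desc A ! i) (eigvals_desc B ! j))\<^sup>2 *
        (eigbasis A i \<bullet> ((B - A) *\<^sub>v eigbasis B j))\<^sup>2)"
proof -
  let ?w = "eigbasis A" and ?v = "eigbasis B"
  note w = eigbasis_orthonormal[OF A] and v = eigbasis_orthonormal[OF B]
  have diff: "?w i \<bullet> ((Y - X) *\<^sub>v ?v j) = (b - a) * (?w i \<bullet> ?v j)"
    if "i < n" "j < n" "symmetric_mat n X" "symmetric_mat n Y"
       "X *\<^sub>v ?w i = a \<cdot>\<^sub>v ?w i" "Y *\<^sub>v ?v j = b \<cdot>\<^sub>v ?v j" for i j X Y a b
  proof -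
    note wi = orthonormal_basisD(1)[OF w that(1)] and vj = orthonormal_basisD(1)[OF v that(2)]
    note XY = symmetric_matD(1)[OF that(3)] symmetric_matD(1)[OF that(4)]
    have "(Y - X) *\<^sub>v ?v j = Y *\<^sub>v ?v j - X *\<^sub>v ?v j"
      using XY vj by (simp add: minus_mult_distrib_mat_vec)
    then have "?w i \<bullet> ((Y - X) *\<^sub>v ?v j) = ?w i \<bullet> (Y *\<^sub>v ?v j) - ?w i \<bullet> (X *\<^sub>v ?v j)"
      using wi vj XY by (simp add: scalar_prod_minus_distrib[of _ n])
    then show ?thesis
      using eigvec_scalar_prod[OF that(3) wi vj that(5)] that(6) wi vj by (simp add: algebra_simps)
  qed
  have "?w i \<bullet> ((mat_fun h B - mat_fun h A) *\<^sub>v ?v j) =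
      divdiff h (eigvals_desc A ! i) (eigvals_desc B ! j) * (?w i \<bullet> ((B - A) *\<^sub>v ?v j))"
    if ij: "i < n" "j < n" for i j
    using diff[OF ij mat_fun_symmetric[OF A, of h] mat_fun_symmetric[OF B, of h]
          mat_fun_eigvec[OF A ij(1)] mat_fun_eigvec[OF B ij(2)]]
      diff[OF ij A B eigenbasis_orthonormal(2)[OF A eigbasis[OF A] ij(1)]
          eigenbasis_orthonormal(2)[OF B eigbasis[OF B] ij(2)]]
    by (simp add: divdiff_mult[symmetric])
  then show ?thesis
    using frobenius_norm_bases[OF w v, of "mat_fun h B - mat_fun h A"]
      mat_fun_carrier[OF A, of h] mat_fun_carrier[OF B, of h]
    by (simp add: power_mult_distrib minus_carrier_mat)
qed

section \<open>Eigenvalues under perturbation\<close>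

text \<open>Weyl's inequality, proved by the dimension count of Courant and Fischer. For a fixed \<open>i\<close>, the
\<open>n - 1\<close> conditions that \<open>x\<close> be orthogonal to the \<open>i\<close> top eigenvectors of \<open>B\<close> and to the \<open>n - 1 - i\<close>
bottom eigenvectors of \<open>A\<close> have a common solution \<open>x \<noteq> 0\<close>. On such an \<open>x\<close> the form of \<open>A\<close> is at least
the \<open>i\<close>-th eigenvalue of \<open>A\<close> and the form of \<open>B\<close> at most the \<open>i\<close>-th eigenvalue of \<open>B\<close>.\<close>

lemma weyl_le:
  assumes A: "symmetric_mat n A" and B: "symmetric_mat n B" and i: "i < n"
    and le: "\<And>x. x \<in> carrier_vec n \<Longrightarrow> x \<bullet> (A *\<^sub>v x) \<le> x \<bullet> (B *\<^sub>v x) + e * (x \<bullet> x)"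
  shows "eigvals_desc A ! i \<le> eigvals_desc B ! i + e"
proof -
  let ?w = "eigbasis A" and ?v = "eigbasis B"
  let ?l = "\<lambda>k. eigvals_desc A ! k" and ?m = "\<lambda>k. eigvals_desc B ! k"
  note w = eigbasis_orthonormal[OF A] and v = eigbasis_orthonormal[OF B]
  note ew = eigenbasis_orthonormal(2)[OF A eigbasis[OF A]]
  note ev = eigenbasis_orthonormal(2)[OF B eigbasis[OF B]]
  \<comment> \<open>The zero row at index \<open>i\<close> makes the system of \<open>n - 1\<close> conditions square and singular.\<close>
  define C where "C = mat n n (\<lambda>(k,c). if k < i then ?v k $ c else if k = i then 0 else ?w k $ c)"
  have C: "C \<in> carrier_mat n n" by (simp add: C_def)
  have "row C i = 0\<^sub>v n" using i by (auto simp: C_def intro!: eq_vecI)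
  then have "transpose_mat C *\<^sub>v unit_vec n i = 0\<^sub>v n"
    using i by (intro eq_vecI) (auto simp: C_def)
  then have "det (transpose_mat C) = 0"
    using i C
    by (intro iffD2[OF det_0_iff_vec_prod_zero[of "transpose_mat C" n]] exI[of _ "unit_vec n i"])
       auto
  then obtain x where x: "x \<in> carrier_vec n" "x \<noteq> 0\<^sub>v n" "C *\<^sub>v x = 0\<^sub>v n"
    using det_transpose[OF C] det_0_iff_vec_prod_zero[OF C] by auto
  have Cx: "(\<Sum>c<n. C $$ (k,c) * x $ c) = 0" if "k < n" for k
    using mult_mat_vec_lessThan[OF C x(1) that] x(3) that by simp
  have vx: "?v k \<bullet> x = 0" if "k < i" for k
    using Cx[of k] that i x(1) by (simp add: C_def scalar_prod_lessThan[where n=n])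
  have wx: "?w k \<bullet> x = 0" if "i < k" "k < n" for k
    using Cx[of k] that i x(1) by (simp add: C_def scalar_prod_lessThan[where n=n])
  have xx: "x \<bullet> x > 0"
  proof -
    have "x \<bullet> x \<ge> 0" using x(1) by (simp add: scalar_prod_lessThan[where n=n] sum_nonneg)
    moreover have "x \<bullet> x \<noteq> 0"
    proof
      assume "x \<bullet> x = 0"
      then have "(\<Sum>k<n. x $ k * x $ k) = 0" using x(1) by (simp add: scalar_prod_lessThan[where n=n])
      then have "\<forall>k<n. x $ k = 0" by (subst (asm) sum_nonneg_eq_0_iff) auto
      then show False using x by (auto intro!: eq_vecI)
    qed
    ultimately show ?thesis by simp
  qed
  have "?l i * (x \<bullet> x) = (\<Sum>k<n. ?l i * (?w k \<bullet> x)\<^sup>2)"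
    unfolding parseval_norm[OF w x(1), symmetric] by (rule sum_distrib_left)
  also have "\<dots> \<le> (\<Sum>k<n. ?l k * (?w k \<bullet> x)\<^sup>2)"
  proof (rule sum_mono)
    fix k assume k: "k \<in> {..<n}"
    show "?l i * (?w k \<bullet> x)\<^sup>2 \<le> ?l k * (?w k \<bullet> x)\<^sup>2"
    proof (cases "k \<le> i")
      case True
      then show ?thesis using eigvals_desc_antimono[of k i A] char_poly_eigvals_desc[OF A] i
        by (intro mult_right_mono) auto
    qed (use wx k in auto)
  qed
  also have "\<dots> = x \<bullet> (A *\<^sub>v x)" using quadratic_form_eigenbasis[OF A w x(1) ew] by simp
  also have "\<dots> \<le> x \<bullet> (B *\<^sub>v x) + e * (x \<bullet> x)" by (rule le[OF x(1)])
  also have "x \<bullet> (B *\<^sub>v x) = (\<Sum>k<n. ?m k * (?v k \<bullet> x)\<^sup>2)"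
    using quadratic_form_eigenbasis[OF B v x(1) ev] by simp
  also have "\<dots> \<le> (\<Sum>k<n. ?m i * (?v k \<bullet> x)\<^sup>2)"
  proof (rule sum_mono)
    fix k assume k: "k \<in> {..<n}"
    show "?m k * (?v k \<bullet> x)\<^sup>2 \<le> ?m i * (?v k \<bullet> x)\<^sup>2"
    proof (cases "i \<le> k")
      case True
      then show ?thesis using eigvals_desc_antimono[of i k B] char_poly_eigvals_desc[OF B] k
        by (intro mult_right_mono) auto
    qed (use vx k in auto)
  qed
  also have "\<dots> = ?m i * (x \<bullet> x)"
    using parseval_norm[OF v x(1)] by (simp add: sum_distrib_left[symmetric])
  finally have "?l i * (x \<bullet> x) \<le> (?m i + e) * (x \<bullet> x)" by (simp add: algebra_simps)
  then show ?thesis using xx by simp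
qed

lemma bilinear_form_bound:
  fixes Z :: "real mat"
  assumes Z: "Z \<in> carrier_mat n n" and x: "x \<in> carrier_vec n" and y: "y \<in> carrier_vec n"
  shows "\<bar>x \<bullet> (Z *\<^sub>v y)\<bar> \<le> (\<Sum>r<n. \<Sum>c<n. \<bar>Z $$ (r,c)\<bar>) * ((x \<bullet> x + y \<bullet> y) / 2)"
proof -
  have sq: "(u $ r)\<^sup>2 \<le> u \<bullet> u" if "u \<in> carrier_vec n" "r < n" for u :: "real vec" and r
    using member_le_sum[of r "{..<n}" "\<lambda>r. (u $ r)\<^sup>2"] that
    by (simp add: scalar_prod_lessThan[where n=n] power2_eq_square)
  have "\<bar>x \<bullet> (Z *\<^sub>v y)\<bar> = \<bar>\<Sum>r<n. \<Sum>c<n. Z $$ (r,c) * (x $ r * y $ c)\<bar>"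
    using Z y mult_mat_vec_lessThan[OF Z y]
    by (simp add: scalar_prod_lessThan[where n=n] sum_distrib_left mult.left_commute[of "x $ _"]
        del: index_mult_mat_vec)
  also have "\<dots> \<le> (\<Sum>r<n. \<Sum>c<n. \<bar>Z $$ (r,c) * (x $ r * y $ c)\<bar>)"
    by (intro order_trans[OF sum_abs] sum_mono) simp
  also have "\<dots> \<le> (\<Sum>r<n. \<Sum>c<n. \<bar>Z $$ (r,c)\<bar> * ((x \<bullet> x + y \<bullet> y) / 2))"
  proof (intro sum_mono)
    fix r c assume "r \<in> {..<n}" "c \<in> {..<n}"
    then have "(x $ r)\<^sup>2 + (y $ c)\<^sup>2 \<le> x \<bullet> x + y \<bullet> y" using sq x y by (simp add: add_mono)
    moreover have "2 * \<bar>x $ r * y $ c\<bar> \<le> (x $ r)\<^sup>2 + (y $ c)\<^sup>2"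
      using sum_squares_bound[of "\<bar>x $ r\<bar>" "\<bar>y $ c\<bar>"] by (simp add: abs_mult)
    ultimately have "\<bar>x $ r * y $ c\<bar> \<le> (x \<bullet> x + y \<bullet> y) / 2" by simp
    then show "\<bar>Z $$ (r,c) * (x $ r * y $ c)\<bar> \<le> \<bar>Z $$ (r,c)\<bar> * ((x \<bullet> x + y \<bullet> y) / 2)"
      unfolding abs_mult[of "Z $$ _"] by (rule mult_left_mono) simp
  qed
  finally show ?thesis by (simp only: sum_distrib_right)
qed

section \<open>Small perturbations of a matrix with simple spectrum\<close>

lemma smult_mat_mult_mat_vec:
  fixes B :: "real mat"
  assumes "B \<in> carrier_mat nr nc" "x \<in> carrier_vec nc"
  shows "(k \<cdot>\<^sub>m B) *\<^sub>v x = k \<cdot>\<^sub>v (B *\<^sub>v x)"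
  using assms by (intro eq_vecI) (auto simp: scalar_prod_def sum_distrib_left mult.assoc)

lemma perturbed_symmetric_mat:
  assumes A: "symmetric_mat n A" and Z: "symmetric_mat n Z"
  shows "symmetric_mat n (perturbed n \<sigma> A Z)"
proof -
  have "A \<in> carrier_mat n n" "Z \<in> carrier_mat n n" using symmetric_matD[OF A] symmetric_matD[OF Z] by auto
  moreover have "A $$ (j,i) = A $$ (i,j)" "Z $$ (j,i) = Z $$ (i,j)" if "i < n" "j < n" for i j
    using that symmetric_matD[OF A] symmetric_matD[OF Z] by (metis index_transpose_mat(1))+
  ultimately show ?thesis
    unfolding symmetric_mat_def perturbed_def by (auto intro!: eq_matI)
qed

text \<open>The family \<open>w\<close> is an arbitrary selection of eigenbases of the perturbed matrices: signs may jump with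
\<open>\<sigma>\<close>, so the vectors themselves need not converge.\<close>

locale small_perturbation =
  fixes n :: nat and A Z :: "real mat" and w :: "real \<Rightarrow> nat \<Rightarrow> real vec"
  assumes n: "n \<ge> 1" and A: "symmetric_mat n A" and Z: "symmetric_mat n Z"
    and simple: "distinct (eigvals_desc A)"
    and w: "\<And>\<sigma>. \<sigma> > 0 \<Longrightarrow> orthonormal_eigenbasis (perturbed n \<sigma> A Z) (w \<sigma>)"
begin

abbreviation "u \<equiv> eigbasis A"
abbreviation "lam i \<equiv> eigvals_desc A ! i"
abbreviation "plam \<sigma> i \<equiv> eigvals_desc (perturbed n \<sigma> A Z) ! i"

text \<open>A bound, independent of \<open>\<sigma>\<close>, for the bilinear form of \<open>Z\<close> on unit vectors.\<close>

definition "entry_sum = (\<Sum>r<n. \<Sum>c<n. \<bar>Z $$ (r,c)\<bar>)"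

lemma u: "orthonormal_basis n u" using eigbasis_orthonormal[OF A] .

lemmas perturbed_symmetric = perturbed_symmetric_mat[OF A Z]

lemma w_orthonormal: "\<sigma> > 0 \<Longrightarrow> orthonormal_basis n (w \<sigma>)"
  using eigenbasis_orthonormal(1)[OF perturbed_symmetric w] .

lemma perturbed_scalar_prod:
  assumes "x \<in> carrier_vec n" "y \<in> carrier_vec n"
  shows "x \<bullet> (perturbed n \<sigma> A Z *\<^sub>v y) = x \<bullet> (A *\<^sub>v y) + \<sigma> / sqrt n * (x \<bullet> (Z *\<^sub>v y))"
proof -
  have c: "A \<in> carrier_mat n n" "Z \<in> carrier_mat n n" using symmetric_matD[OF A] symmetric_matD[OF Z] by auto
  have "perturbed n \<sigma> A Z *\<^sub>v y = A *\<^sub>v y + (\<sigma> / sqrt n) \<cdot>\<^sub>v (Z *\<^sub>v y)"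
    using c assms by (simp add: perturbed_def add_mult_distrib_mat_vec[of _ n n] smult_mat_mult_mat_vec[of _ n n])
  then show ?thesis using c assms
    by (simp add: scalar_prod_add_distrib[of _ n] scalar_prod_smult_distrib[of _ n])
qed

lemma plam_bound:
  assumes i: "i < n"
  shows "\<bar>plam \<sigma> i - lam i\<bar> \<le> \<bar>\<sigma>\<bar> / sqrt n * entry_sum"
proof -
  have b: "\<bar>\<sigma> / sqrt n * (x \<bullet> (Z *\<^sub>v x))\<bar> \<le> \<bar>\<sigma>\<bar> / sqrt n * entry_sum * (x \<bullet> x)" if "x \<in> carrier_vec n" for x
    using mult_left_mono[OF bilinear_form_bound[OF symmetric_matD(1)[OF Z] that that], of "\<bar>\<sigma>\<bar> / sqrt n"]
    by (simp add: abs_mult entry_sum_def mult.assoc)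
  have "lam i \<le> plam \<sigma> i + \<bar>\<sigma>\<bar> / sqrt n * entry_sum"
    
  proof (rule weyl_le[OF A perturbed_symmetric i])
    fix x :: "real vec" assume x: "x \<in> carrier_vec n"
    show "x \<bullet> (A *\<^sub>v x) \<le> x \<bullet> (perturbed n \<sigma> A Z *\<^sub>v x) + \<bar>\<sigma>\<bar> / sqrt n * entry_sum * (x \<bullet> x)"
      using abs_le_D2[OF b[OF x]] unfolding perturbed_scalar_prod[OF x x] by linarith
  qed
  moreover have "plam \<sigma> i \<le> lam i + \<bar>\<sigma>\<bar> / sqrt n * entry_sum"
    
  proof (rule weyl_le[OF perturbed_symmetric A i])
    fix x :: "real vec" assume x: "x \<in> carrier_vec n"
    show "x \<bullet> (perturbed n \<sigma> A Z *\<^sub>v x) \<le> x \<bullet> (A *\<^sub>v x) + \<bar>\<sigma>\<bar> / sqrt n * entry_sum * (x \<bullet> x)"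
      using abs_le_D1[OF b[OF x]] unfolding perturbed_scalar_prod[OF x x] by linarith
  qed
  ultimately show ?thesis by linarith
qed

lemma plam_tendsto:
  assumes "i < n"
  shows "((\<lambda>\<sigma>. plam \<sigma> i) \<longlongrightarrow> lam i) (at_right 0)"
proof -
  have "((\<lambda>\<sigma>. \<bar>\<sigma>\<bar> / sqrt n * entry_sum) \<longlongrightarrow> \<bar>0\<bar> / sqrt n * entry_sum) (at_right 0)"
    by (intro tendsto_intros) (use n in auto)
  then have lim: "((\<lambda>\<sigma>. \<bar>\<sigma>\<bar> / sqrt n * entry_sum) \<longlongrightarrow> 0) (at_right 0)" by simp
  have "\<forall>\<^sub>F \<sigma> in at_right 0. norm (plam \<sigma> i - lam i) \<le> \<bar>\<sigma>\<bar> / sqrt n * entry_sum"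
    using plam_bound[OF assms] by (intro always_eventually) simp
  from Lim_null_comparison[OF this lim] show ?thesis by (simp add: LIM_zero_iff)
qed

lemma overlap_eq:
  assumes "\<sigma> > 0" "i < n" "j < n"
  shows "(plam \<sigma> i - lam j) * (u j \<bullet> w \<sigma> i) = \<sigma> / sqrt n * (u j \<bullet> (Z *\<^sub>v w \<sigma> i))"
proof -
  note uj = orthonormal_basisD(1)[OF u assms(3)]
  note wi = orthonormal_basisD(1)[OF w_orthonormal[OF assms(1)] assms(2)]
  have "u j \<bullet> (perturbed n \<sigma> A Z *\<^sub>v w \<sigma> i) = plam \<sigma> i * (u j \<bullet> w \<sigma> i)"
    using eigenbasis_orthonormal(2)[OF perturbed_symmetric w[OF assms(1)] assms(2)] uj wi by simp
  moreover have "u j \<bullet> (A *\<^sub>v w \<sigma> i) = lam j * (u j \<bullet> w \<sigma> i)"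
    using eigvec_scalar_prod[OF A uj wi] eigenbasis_orthonormal(2)[OF A eigbasis[OF A] assms(3)] by simp
  ultimately show ?thesis using perturbed_scalar_prod[OF uj wi, of \<sigma>] by (simp add: algebra_simps)
qed

text \<open>By Weyl's inequality \<open>plam \<sigma> i\<close> eventually stays at distance at least half the gap \<open>\<bar>lam i - lam j\<bar>\<close>
from \<open>lam j\<close>, so the factor in front of the overlap in \<open>overlap_eq\<close> can be divided out, while the other
side is \<open>O(\<sigma>)\<close>. The gap is positive because the spectrum of \<open>A\<close> is simple.\<close>

lemma overlap_small:
  assumes ij: "i < n" "j < n" "i \<noteq> j"
  shows "\<exists>K. \<forall>\<^sub>F \<sigma> in at_right 0. \<bar>u j \<bullet> w \<sigma> i\<bar> \<le> K * \<sigma>"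
proof -
  define g where "g = \<bar>lam i - lam j\<bar>"
  have g: "g > 0"
    using simple ij char_poly_eigvals_desc(2)[OF A] by (simp add: g_def nth_eq_iff_index_eq)
  have "\<forall>\<^sub>F \<sigma> in at_right 0. dist (plam \<sigma> i) (lam i) < g / 2"
    using tendstoD[OF plam_tendsto[OF ij(1)], of "g/2"] g by simp
  then have "\<forall>\<^sub>F \<sigma> in at_right 0. \<bar>u j \<bullet> w \<sigma> i\<bar> \<le> (2 * entry_sum / (g * sqrt n)) * \<sigma>"
    using eventually_at_right_less[of "0::real"]
  proof eventually_elim
    case (elim \<sigma>)
    note wo = w_orthonormal[OF elim(2)]
    have "g / 2 \<le> \<bar>plam \<sigma> i - lam j\<bar>" 
      using elim(1) abs_triangle_ineq4[of "plam \<sigma> i - lam j" "plam \<sigma> i - lam i"]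
      unfolding g_def dist_real_def by simp
    then have "g / 2 * \<bar>u j \<bullet> w \<sigma> i\<bar> \<le> \<bar>(plam \<sigma> i - lam j) * (u j \<bullet> w \<sigma> i)\<bar>"
      unfolding abs_mult by (rule mult_right_mono) simp
    also have "\<dots> = \<sigma> / sqrt n * \<bar>u j \<bullet> (Z *\<^sub>v w \<sigma> i)\<bar>"
      using overlap_eq[OF elim(2) ij(1,2)] elim(2) by (simp add: abs_mult)
    also have "\<dots> \<le> \<sigma> / sqrt n * entry_sum"
      using bilinear_form_bound[OF symmetric_matD(1)[OF Z] orthonormal_basisD(1)[OF u ij(2)]
          orthonormal_basisD(1)[OF wo ij(1)]] elim(2)
        orthonormal_basisD(3)[OF u ij(2)] orthonormal_basisD(3)[OF wo ij(1)]
      by (intro mult_left_mono) (auto simp: entry_sum_def)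
    finally show ?case using g n by (simp add: field_simps)
  qed
  then show ?thesis by blast
qed

lemma overlap_sq_over_tendsto_0:
  assumes ij: "i < n" "j < n" "i \<noteq> j"
  shows "((\<lambda>\<sigma>. (u j \<bullet> w \<sigma> i)\<^sup>2 / \<sigma>) \<longlongrightarrow> 0) (at_right 0)"
proof -
  obtain K where K: "\<forall>\<^sub>F \<sigma> in at_right 0. \<bar>u j \<bullet> w \<sigma> i\<bar> \<le> K * \<sigma>" using overlap_small[OF ij] by blast
  have lim: "((\<lambda>\<sigma>. K\<^sup>2 * \<sigma>) \<longlongrightarrow> 0) (at_right 0)"
    by (intro tendsto_mult_right_zero tendsto_ident_at)
  have "\<forall>\<^sub>F \<sigma> in at_right 0. norm ((u j \<bullet> w \<sigma> i)\<^sup>2 / \<sigma>) \<le> K\<^sup>2 * \<sigma>"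
    using K eventually_at_right_less[of "0::real"]
  proof eventually_elim
    case (elim \<sigma>)
    have "(u j \<bullet> w \<sigma> i)\<^sup>2 \<le> (K * \<sigma>)\<^sup>2" using elim(1) by (metis abs_ge_zero power2_abs power_mono)
    then show ?case using elim(2) by (simp add: field_simps power2_eq_square)
  qed
  from Lim_null_comparison[OF this lim] show ?thesis .
qed

lemma overlap_tendsto_0:
  assumes ij: "i < n" "j < n" "i \<noteq> j"
  shows "((\<lambda>\<sigma>. u j \<bullet> w \<sigma> i) \<longlongrightarrow> 0) (at_right 0)"
proof -
  obtain K where K: "\<forall>\<^sub>F \<sigma> in at_right 0. \<bar>u j \<bullet> w \<sigma> i\<bar> \<le> K * \<sigma>" using overlap_small[OF ij] by blast
  have lim: "((\<lambda>\<sigma>. K * \<sigma>) \<longlongrightarrow> 0) (at_right 0)"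
    by (intro tendsto_mult_right_zero tendsto_ident_at)
  have "\<forall>\<^sub>F \<sigma> in at_right 0. norm (u j \<bullet> w \<sigma> i) \<le> K * \<sigma>" using K by simp
  from Lim_null_comparison[OF this lim] show ?thesis .
qed

lemma overlap_sq_sum:
  assumes "\<sigma> > 0" "i < n"
  shows "(\<Sum>j<n. (u j \<bullet> w \<sigma> i)\<^sup>2) = 1"
  using parseval_norm[OF u orthonormal_basisD(1)[OF w_orthonormal assms(2)]]
    orthonormal_basisD(3)[OF w_orthonormal assms(2)] assms(1) by simp

lemma overlap_sq_tendsto_1:
  assumes i: "i < n"
  shows "((\<lambda>\<sigma>. (u i \<bullet> w \<sigma> i)\<^sup>2) \<longlongrightarrow> 1) (at_right 0)"
proof -
  have "((\<lambda>\<sigma>. 1 - (\<Sum>j\<in>{..<n}-{i}. (u j \<bullet> w \<sigma> i)\<^sup>2)) \<longlongrightarrow> 1 - (\<Sum>j\<in>{..<n}-{i}. 0\<^sup>2)) (at_right 0)"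
    by (intro tendsto_intros overlap_tendsto_0) (use i in auto)
  moreover have "\<forall>\<^sub>F \<sigma> in at_right 0. 1 - (\<Sum>j\<in>{..<n}-{i}. (u j \<bullet> w \<sigma> i)\<^sup>2) = (u i \<bullet> w \<sigma> i)\<^sup>2"
    using eventually_at_right_less[of "0::real"]
  proof eventually_elim
    case (elim \<sigma>)
    show ?case using overlap_sq_sum[OF elim i] i by (subst (asm) sum.remove[of _ i]) auto
  qed
  ultimately show ?thesis by (auto elim: Lim_transform_eventually)
qed

text \<open>The perturbed eigenvector tends to the \<open>i\<close>-th one only up to sign; products of two of its coordinates
do not see the sign.\<close>

lemma overlap_prod_tendsto:
  assumes i: "i < n" "j < n" "k < n"
  shows "((\<lambda>\<sigma>. (u j \<bullet> w \<sigma> i) * (u k \<bullet> w \<sigma> i)) \<longlongrightarrow> (if j = i \<and> k = i then 1 else 0)) (at_right 0)"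
proof -
  have le1: "\<forall>\<^sub>F \<sigma> in at_right 0. \<bar>u k \<bullet> w \<sigma> i\<bar> \<le> 1" if "k < n" for k
    using eventually_at_right_less[of "0::real"]
  proof eventually_elim
    case (elim \<sigma>)
    have "(u k \<bullet> w \<sigma> i)\<^sup>2 \<le> 1"
      using overlap_sq_sum[OF elim i(1)] member_le_sum[of k "{..<n}" "\<lambda>j. (u j \<bullet> w \<sigma> i)\<^sup>2"] that by simp
    then show ?case by (simp add: abs_square_le_1)
  qed
  have *: "((\<lambda>\<sigma>. (u j \<bullet> w \<sigma> i) * (u k \<bullet> w \<sigma> i)) \<longlongrightarrow> 0) (at_right 0)" if "j \<noteq> i" "j < n" "k < n" for j k
  proof (rule Lim_null_comparison)
    show "((\<lambda>\<sigma>. \<bar>u j \<bullet> w \<sigma> i\<bar>) \<longlongrightarrow> 0) (at_right 0)"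
      using overlap_tendsto_0[of i j] that i by (auto intro: tendsto_rabs_zero)
    show "\<forall>\<^sub>F \<sigma> in at_right 0. norm ((u j \<bullet> w \<sigma> i) * (u k \<bullet> w \<sigma> i)) \<le> \<bar>u j \<bullet> w \<sigma> i\<bar>"
      using le1[OF that(3)] by eventually_elim (simp add: abs_mult mult_left_le)
  qed
  show ?thesis
    using *[of j k] *[of k j] i overlap_sq_tendsto_1[OF i(1)]
    by (cases "j = i"; cases "k = i") (auto simp: mult.commute power2_eq_square)
qed

text \<open>The term \<open>j = i\<close> drops out of \<open>\<Sum>\<^sub>j (h(\<lambda>\<^sub>j) - h(\<lambda>\<^sub>i)) (u\<^sub>j \<bullet> w\<^sub>i)\<^sup>2\<close>, and the other squared overlaps are
\<open>O(\<sigma>\<^sup>2)\<close>. The maximum is controlled by the sum over \<open>i\<close>.\<close>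

theorem oracle_tendsto:
  "((\<lambda>\<sigma>. MAX i\<in>{..<n}. \<bar>w \<sigma> i \<bullet> (mat_fun h A *\<^sub>v w \<sigma> i) - h (lam i)\<bar> / \<sigma>) \<longlongrightarrow> 0) (at_right 0)"
proof -
  let ?d = "\<lambda>\<sigma> i. \<bar>w \<sigma> i \<bullet> (mat_fun h A *\<^sub>v w \<sigma> i) - h (lam i)\<bar> / \<sigma>"
  have d: "((\<lambda>\<sigma>. ?d \<sigma> i) \<longlongrightarrow> 0) (at_right 0)" if i: "i < n" for i
  proof (rule Lim_null_comparison)
    have "((\<lambda>\<sigma>. \<Sum>j<n. \<bar>h (lam j) - h (lam i)\<bar> * ((u j \<bullet> w \<sigma> i)\<^sup>2 / \<sigma>)) \<longlongrightarrow> (\<Sum>j<n. 0)) (at_right 0)"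
    proof (rule tendsto_sum)
      fix j assume j: "j \<in> {..<n}"
      show "((\<lambda>\<sigma>. \<bar>h (lam j) - h (lam i)\<bar> * ((u j \<bullet> w \<sigma> i)\<^sup>2 / \<sigma>)) \<longlongrightarrow> 0) (at_right 0)"
      proof (cases "i = j")
        case False
        then show ?thesis using overlap_sq_over_tendsto_0[of i j] i j by (intro tendsto_mult_right_zero) auto
      qed simp
    qed
    then show "((\<lambda>\<sigma>. \<Sum>j<n. \<bar>h (lam j) - h (lam i)\<bar> * ((u j \<bullet> w \<sigma> i)\<^sup>2 / \<sigma>)) \<longlongrightarrow> 0) (at_right 0)" by simp
    show "\<forall>\<^sub>F \<sigma> in at_right 0. norm (?d \<sigma> i) \<le> (\<Sum>j<n. \<bar>h (lam j) - h (lam i)\<bar> * ((u j \<bullet> w \<sigma> i)\<^sup>2 / \<sigma>))"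
      using eventually_at_right_less[of "0::real"]
    proof eventually_elim
      case (elim \<sigma>)
      note wi = orthonormal_basisD(1)[OF w_orthonormal[OF elim] i]
      have "w \<sigma> i \<bullet> (mat_fun h A *\<^sub>v w \<sigma> i) - h (lam i) =
          (\<Sum>j<n. h (lam j) * (u j \<bullet> w \<sigma> i)\<^sup>2) - h (lam i) * (\<Sum>j<n. (u j \<bullet> w \<sigma> i)\<^sup>2)"
        using quadratic_form_eigenbasis[OF mat_fun_symmetric[OF A] u wi mat_fun_eigvec[OF A]]
          overlap_sq_sum[OF elim i] by simp
      also have "\<dots> = (\<Sum>j<n. (h (lam j) - h (lam i)) * (u j \<bullet> w \<sigma> i)\<^sup>2)"
        by (simp add: sum_distrib_left sum_subtractf[symmetric] left_diff_distrib)
      finally have "\<bar>w \<sigma> i \<bullet> (mat_fun h A *\<^sub>v w \<sigma> i) - h (lam i)\<bar> \<le> (\<Sum>j<n. \<bar>h (lam j) - h (lam i)\<bar> * (u j \<bullet> w \<sigma> i)\<^sup>2)"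
        using sum_abs[of "\<lambda>j. (h (lam j) - h (lam i)) * (u j \<bullet> w \<sigma> i)\<^sup>2" "{..<n}"] by (simp add: abs_mult)
      then show ?case using elim
        by (simp add: sum_divide_distrib[symmetric] divide_right_mono)
    qed
  qed
  have "((\<lambda>\<sigma>. \<Sum>i<n. ?d \<sigma> i) \<longlongrightarrow> (\<Sum>i<n. 0)) (at_right 0)"
    using d by (intro tendsto_sum) auto
  then have lim: "((\<lambda>\<sigma>. \<Sum>i<n. ?d \<sigma> i) \<longlongrightarrow> 0) (at_right 0)" by simp
  show ?thesis
  proof (rule Lim_null_comparison[OF _ lim])
    show "\<forall>\<^sub>F \<sigma> in at_right 0. norm (MAX i\<in>{..<n}. ?d \<sigma> i) \<le> (\<Sum>i<n. ?d \<sigma> i)"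
      using eventually_at_right_less[of "0::real"]
    proof eventually_elim
      case (elim \<sigma>)
      have "(MAX i\<in>{..<n}. ?d \<sigma> i) \<in> ?d \<sigma> ` {..<n}" using n by (intro Max_in) (auto simp: lessThan_empty_iff)
      then obtain i where "i < n" "(MAX i\<in>{..<n}. ?d \<sigma> i) = ?d \<sigma> i" by auto
      then show ?case using elim member_le_sum[of i "{..<n}" "?d \<sigma>"] by simp
    qed
  qed
qed

lemma squared_overlap_tendsto:
  assumes i: "i < n" and y: "y \<in> carrier_vec n"
  shows "((\<lambda>\<sigma>. (y \<bullet> w \<sigma> i)\<^sup>2) \<longlongrightarrow> (y \<bullet> u i)\<^sup>2) (at_right 0)"
proof -
  have "((\<lambda>\<sigma>. \<Sum>j<n. \<Sum>k<n. (u j \<bullet> y) * (u k \<bullet> y) * ((u j \<bullet> w \<sigma> i) * (u k \<bullet> w \<sigma> i))) \<longlongrightarrow>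
      (\<Sum>j<n. \<Sum>k<n. (u j \<bullet> y) * (u k \<bullet> y) * (if j = i \<and> k = i then 1 else 0))) (at_right 0)"
    using i by (intro tendsto_intros overlap_prod_tendsto) auto
  also have "(\<Sum>j<n. \<Sum>k<n. (u j \<bullet> y) * (u k \<bullet> y) * (if j = i \<and> k = i then 1 else 0)) =
      (\<Sum>j<n. if j = i then (u i \<bullet> y) * (u i \<bullet> y) else 0)"
  proof (rule sum.cong[OF refl])
    fix j
    show "(\<Sum>k<n. (u j \<bullet> y) * (u k \<bullet> y) * (if j = i \<and> k = i then 1 else 0)) =
        (if j = i then (u i \<bullet> y) * (u i \<bullet> y) else 0)"
      using i by (cases "j = i") (simp_all add: if_distrib[of "\<lambda>x. _ * x"] cong: if_cong)
  qed
  also have "\<dots> = (y \<bullet> u i)\<^sup>2"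
    using i y orthonormal_basisD(1)[OF u i] by (simp add: power2_eq_square comm_scalar_prod[of _ n])
  finally show ?thesis
  proof (rule Lim_transform_eventually)
    show "\<forall>\<^sub>F \<sigma> in at_right 0. (\<Sum>j<n. \<Sum>k<n. (u j \<bullet> y) * (u k \<bullet> y) * ((u j \<bullet> w \<sigma> i) * (u k \<bullet> w \<sigma> i))) = (y \<bullet> w \<sigma> i)\<^sup>2"
      using eventually_at_right_less[of "0::real"]
    proof eventually_elim
      case (elim \<sigma>)
      show ?case
        unfolding parseval[OF u y orthonormal_basisD(1)[OF w_orthonormal[OF elim] i], symmetric]
        by (simp add: power2_eq_square sum_product mult_ac)
    qed
  qed
qed

end

definition limit_form :: "(real \<Rightarrow> real) \<Rightarrow> nat \<Rightarrow> real mat \<Rightarrow> real mat \<Rightarrow> real" where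
  "limit_form h n A Z =
     (\<Sum>i<n. \<Sum>j<n. (divdiff h (eigvals_desc A ! i) (eigvals_desc A ! j))\<^sup>2 *
        (eigbasis A i \<bullet> (Z *\<^sub>v eigbasis A j))\<^sup>2) / (real n)\<^sup>2"

text \<open>In the exact identity for \<open>A\<close> and its perturbation the factor \<open>\<sigma>\<^sup>2 / n\<close> cancels against the
normalisation. What is left converges termwise, by continuity of the divided difference in its second
argument and by convergence of the perturbed eigenvectors up to sign.\<close>

theorem frobenius_perturbed_tendsto:
  assumes n: "n \<ge> 1" and A: "symmetric_mat n A" and Z: "symmetric_mat n Z"
    and simple: "distinct (eigvals_desc A)" and cont: "\<And>s t. isCont (divdiff h s) t"
  shows "((\<lambda>\<sigma>. (frobenius_norm (mat_fun h (perturbed n \<sigma> A Z) - mat_fun h A))\<^sup>2 / (real n * \<sigma>\<^sup>2)) \<longlongrightarrow> limit_form h n A Z) (at_right 0)"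
proof -
  define w where "w \<sigma> = eigbasis (perturbed n \<sigma> A Z)" for \<sigma>
  have AZ: "A \<in> carrier_mat n n" "Z \<in> carrier_mat n n" using symmetric_matD[OF A] symmetric_matD[OF Z] by auto
  note sym = perturbed_symmetric_mat[OF A Z]
  interpret small_perturbation n A Z w
    by unfold_locales (use assms in \<open>auto simp: w_def intro!: eigbasis[OF sym]\<close>)
  have swap: "x \<bullet> (Z *\<^sub>v y) = (Z *\<^sub>v x) \<bullet> y" if "x \<in> carrier_vec n" "y \<in> carrier_vec n" for x y
    using symmetric_mat_scalar_prod[OF Z that] by simp
  have g: "((\<lambda>\<sigma>. divdiff h (lam i) (plam \<sigma> j)) \<longlongrightarrow> divdiff h (lam i) (lam j)) (at_right 0)" if "j < n" for i j
    using isCont_tendsto_compose[OF cont plam_tendsto[OF that]] .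
  have "((\<lambda>\<sigma>. (\<Sum>i<n. \<Sum>j<n. (divdiff h (lam i) (plam \<sigma> j))\<^sup>2 * ((Z *\<^sub>v u i) \<bullet> w \<sigma> j)\<^sup>2) / (real n)\<^sup>2) \<longlongrightarrow>
     (\<Sum>i<n. \<Sum>j<n. (divdiff h (lam i) (lam j))\<^sup>2 * ((Z *\<^sub>v u i) \<bullet> u j)\<^sup>2) / (real n)\<^sup>2) (at_right 0)"
    using n AZ orthonormal_basisD(1)[OF u] by (intro tendsto_intros g squared_overlap_tendsto) auto
  then have "((\<lambda>\<sigma>. (\<Sum>i<n. \<Sum>j<n. (divdiff h (lam i) (plam \<sigma> j))\<^sup>2 * ((Z *\<^sub>v u i) \<bullet> w \<sigma> j)\<^sup>2) / (real n)\<^sup>2) \<longlongrightarrow>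
     (\<Sum>i<n. \<Sum>j<n. (divdiff h (lam i) (lam j))\<^sup>2 * (u i \<bullet> (Z *\<^sub>v u j))\<^sup>2) / (real n)\<^sup>2) (at_right 0)"
    using orthonormal_basisD(1)[OF u] by (simp add: swap)
  then show ?thesis
    unfolding limit_form_def
  proof (rule Lim_transform_eventually)
    show "\<forall>\<^sub>F \<sigma> in at_right 0. (\<Sum>i<n. \<Sum>j<n. (divdiff h (lam i) (plam \<sigma> j))\<^sup>2 * ((Z *\<^sub>v u i) \<bullet> w \<sigma> j)\<^sup>2) / (real n)\<^sup>2
       = (frobenius_norm (mat_fun h (perturbed n \<sigma> A Z) - mat_fun h A))\<^sup>2 / (real n * \<sigma>\<^sup>2)"
      using eventually_at_right_less[of "0::real"]
    proof eventually_elim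
      case (elim \<sigma>)
      have "perturbed n \<sigma> A Z - A = (\<sigma> / sqrt n) \<cdot>\<^sub>m Z"
        using AZ by (intro eq_matI) (auto simp: perturbed_def)
      then have "u i \<bullet> ((perturbed n \<sigma> A Z - A) *\<^sub>v w \<sigma> j) = \<sigma> / sqrt n * ((Z *\<^sub>v u i) \<bullet> w \<sigma> j)"
        if "i < n" "j < n" for i j
        using AZ orthonormal_basisD(1)[OF u that(1)] orthonormal_basisD(1)[OF w_orthonormal[OF elim] that(2)]
        by (simp add: smult_mat_mult_mat_vec[of _ n n] swap[symmetric])
      then have "(frobenius_norm (mat_fun h (perturbed n \<sigma> A Z) - mat_fun h A))\<^sup>2 =
         (\<Sum>i<n. \<Sum>j<n. \<sigma>\<^sup>2 / n * ((divdiff h (lam i) (plam \<sigma> j))\<^sup>2 * ((Z *\<^sub>v u i) \<bullet> w \<sigma> j)\<^sup>2))"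
        unfolding frobenius_mat_fun_diff[OF A sym]
        by (intro sum.cong refl) (simp add: w_def[symmetric] power_mult_distrib power_divide)
      also have "\<dots> = \<sigma>\<^sup>2 / n * (\<Sum>i<n. \<Sum>j<n. (divdiff h (lam i) (plam \<sigma> j))\<^sup>2 * ((Z *\<^sub>v u i) \<bullet> w \<sigma> j)\<^sup>2)"
        by (simp only: sum_distrib_left)
      finally show ?case using elim n by (simp add: power2_eq_square)
    qed
  qed
qed

section \<open>Moments of Gaussian linear forms\<close>

text \<open>A linear form in independent centred Gaussians is a centred Gaussian whose variance is the weighted
sum of squares of its coefficients.\<close>

lemma (in prob_space) gaussian_sum_moments:
  assumes "finite I" and ind: "indep_vars (\<lambda>_. borel) X I"
    and X: "\<And>p. p \<in> I \<Longrightarrow> distributed M lborel (X p) (normal_density 0 (s p))"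
    and s: "\<And>p. p \<in> I \<Longrightarrow> 0 < s p"
  shows "integrable M (\<lambda>\<omega>. (\<Sum>p\<in>I. c p * X p \<omega>) ^ 4)"
    and "expectation (\<lambda>\<omega>. (\<Sum>p\<in>I. c p * X p \<omega>) ^ 4) = 3 * (\<Sum>p\<in>I. (c p * s p)\<^sup>2)\<^sup>2"
    and "integrable M (\<lambda>\<omega>. (\<Sum>p\<in>I. c p * X p \<omega>)\<^sup>2)"
    and "expectation (\<lambda>\<omega>. (\<Sum>p\<in>I. c p * X p \<omega>)\<^sup>2) = (\<Sum>p\<in>I. (c p * s p)\<^sup>2)"
proof -
  \<comment> \<open>Terms with coefficient 0 are degenerate rather than Gaussian and have to be removed first.\<close>
  define J where "J = {p\<in>I. c p \<noteq> 0}"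
  have J: "finite J" "J \<subseteq> I" using assms(1) by (auto simp: J_def)
  have sumJ: "(\<Sum>p\<in>I. c p * X p \<omega>) = (\<Sum>p\<in>J. c p * X p \<omega>)" for \<omega>
    using assms(1) by (intro sum.mono_neutral_right) (auto simp: J_def)
  have varJ: "(\<Sum>p\<in>I. (c p * s p)\<^sup>2) = (\<Sum>p\<in>J. (c p * s p)\<^sup>2)"
    using assms(1) by (intro sum.mono_neutral_right) (auto simp: J_def)
  let ?Y = "\<lambda>\<omega>. \<Sum>p\<in>J. c p * X p \<omega>" and ?v = "\<Sum>p\<in>J. (c p * s p)\<^sup>2"
  have "integrable M (\<lambda>\<omega>. ?Y \<omega> ^ 4) \<and> expectation (\<lambda>\<omega>. ?Y \<omega> ^ 4) = 3 * ?v\<^sup>2 \<and>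
    integrable M (\<lambda>\<omega>. (?Y \<omega>)\<^sup>2) \<and> expectation (\<lambda>\<omega>. (?Y \<omega>)\<^sup>2) = ?v"
  proof (cases "J = {}")
    case False
    have indJ: "indep_vars (\<lambda>_. borel) (\<lambda>p \<omega>. c p * X p \<omega>) J"
      using indep_vars_compose2[OF indep_vars_subset[OF ind J(2)], of "\<lambda>p x. c p * x" "\<lambda>_. borel"] by simp
    have "distributed M lborel (\<lambda>\<omega>. c p * X p \<omega>) (normal_density 0 (\<bar>c p\<bar> * s p))" if "p \<in> J" for p
      using normal_density_affine[OF X s, of p "c p" 0] that J(2) by (auto simp: J_def)
    from sum_indep_normal[OF J(1) False indJ _ this]
    have Y: "distributed M lborel ?Y (normal_density 0 (sqrt ?v))"
      using s J(2) by (auto simp: J_def power_mult_distrib subset_iff)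
    have "s p \<noteq> 0" if "p \<in> I" for p using s[OF that] by simp
    then have v: "?v > 0" using False J by (intro sum_pos) (auto simp: J_def)
    have m: "has_bochner_integral lborel (\<lambda>x. normal_density 0 (sqrt ?v) x * x ^ (2 * k))
        (fact (2 * k) / ((2 / ?v)^k * fact k))" for k
      using normal_moment_even[of "sqrt ?v" 0 k] v by simp
    have nn: "0 \<le> normal_density 0 (sqrt ?v) x" for x by simp
    have f4: "fact 4 = (24::real)" by (simp add: fact_numeral)
    have I4: "integrable M (\<lambda>\<omega>. ?Y \<omega> ^ 4)"
      using distributed_integrable[OF Y, of "\<lambda>x. x^4"] m[of 2] by (auto simp: has_bochner_integral_iff)
    have E4: "expectation (\<lambda>\<omega>. ?Y \<omega> ^ 4) = 3 * ?v\<^sup>2"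
      using distributed_integral[OF Y, of "\<lambda>x. x^4"] m[of 2] v
      by (simp add: has_bochner_integral_iff f4 power2_eq_square)
    have m2: "has_bochner_integral lborel (\<lambda>x. normal_density 0 (sqrt ?v) x * x\<^sup>2) ?v"
      using m[of 1] by simp
    have I2: "integrable M (\<lambda>\<omega>. (?Y \<omega>)\<^sup>2)"
      using distributed_integrable[OF Y, of "\<lambda>x. x\<^sup>2"] integrable.intros[OF m2] by simp
    have "(\<integral>x. normal_density 0 (sqrt ?v) x * x\<^sup>2 \<partial>lborel) = expectation (\<lambda>\<omega>. (?Y \<omega>)\<^sup>2)"
      by (rule distributed_integral[OF Y]) auto
    then have E2: "expectation (\<lambda>\<omega>. (?Y \<omega>)\<^sup>2) = ?v"
      using has_bochner_integral_integral_eq[OF m2] by argo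
    show ?thesis using I4 E4 I2 E2 by blast
  qed simp
  then show "integrable M (\<lambda>\<omega>. (\<Sum>p\<in>I. c p * X p \<omega>) ^ 4)"
    and "expectation (\<lambda>\<omega>. (\<Sum>p\<in>I. c p * X p \<omega>) ^ 4) = 3 * (\<Sum>p\<in>I. (c p * s p)\<^sup>2)\<^sup>2"
    and "integrable M (\<lambda>\<omega>. (\<Sum>p\<in>I. c p * X p \<omega>)\<^sup>2)"
    and "expectation (\<lambda>\<omega>. (\<Sum>p\<in>I. c p * X p \<omega>)\<^sup>2) = (\<Sum>p\<in>I. (c p * s p)\<^sup>2)"
    unfolding sumJ varJ by blast+
qed

text \<open>The mixed moment of two linear forms \<open>a\<close>, \<open>b\<close> follows from fourth moments by polarisation:
\<open>12 a\<^sup>2 b\<^sup>2 = (a + b)\<^sup>4 + (a - b)\<^sup>4 - 2 a\<^sup>4 - 2 b\<^sup>4\<close>, and \<open>a \<plusminus> b\<close> are linear forms again.\<close>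

lemma (in prob_space) gaussian_sum_squares_moment:
  assumes "finite I" and ind: "indep_vars (\<lambda>_. borel) X I"
    and X: "\<And>p. p \<in> I \<Longrightarrow> distributed M lborel (X p) (normal_density 0 (s p))"
    and s: "\<And>p. p \<in> I \<Longrightarrow> 0 < s p"
  shows "has_bochner_integral M (\<lambda>\<omega>. (\<Sum>p\<in>I. c p * X p \<omega>)\<^sup>2 * (\<Sum>p\<in>I. d p * X p \<omega>)\<^sup>2)
      ((\<Sum>p\<in>I. (c p * s p)\<^sup>2) * (\<Sum>p\<in>I. (d p * s p)\<^sup>2) + 2 * (\<Sum>p\<in>I. c p * d p * (s p)\<^sup>2)\<^sup>2)"
proof -
  let ?a = "\<lambda>\<omega>. \<Sum>p\<in>I. c p * X p \<omega>" and ?b = "\<lambda>\<omega>. \<Sum>p\<in>I. d p * X p \<omega>"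
  let ?A = "\<Sum>p\<in>I. (c p * s p)\<^sup>2" and ?B = "\<Sum>p\<in>I. (d p * s p)\<^sup>2"
  let ?C = "\<Sum>p\<in>I. c p * d p * (s p)\<^sup>2"
  have h: "has_bochner_integral M (\<lambda>\<omega>. (\<Sum>p\<in>I. e p * X p \<omega>) ^ 4) (3 * (\<Sum>p\<in>I. (e p * s p)\<^sup>2)\<^sup>2)" for e
    using gaussian_sum_moments[OF assms, of e] by (simp add: has_bochner_integral_iff)
  have plus: "(\<Sum>p\<in>I. (c p + d p) * X p \<omega>) = ?a \<omega> + ?b \<omega>" for \<omega>
    by (simp add: distrib_right sum.distrib)
  have minus: "(\<Sum>p\<in>I. (c p - d p) * X p \<omega>) = ?a \<omega> - ?b \<omega>" for \<omega>
    by (simp add: left_diff_distrib sum_subtractf)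
  have vplus: "(\<Sum>p\<in>I. ((c p + d p) * s p)\<^sup>2) = ?A + ?B + 2 * ?C"
    by (simp add: power2_eq_square algebra_simps sum.distrib sum_distrib_left)
  have vminus: "(\<Sum>p\<in>I. ((c p - d p) * s p)\<^sup>2) = ?A + ?B - 2 * ?C"
    by (simp add: power2_eq_square algebra_simps sum.distrib sum_distrib_left sum_subtractf)
  have "has_bochner_integral M (\<lambda>\<omega>. ((?a \<omega> + ?b \<omega>) ^ 4 + (?a \<omega> - ?b \<omega>) ^ 4 - 2 * ?a \<omega> ^ 4 - 2 * ?b \<omega> ^ 4) * (1/12))
     ((3 * (?A + ?B + 2 * ?C)\<^sup>2 + 3 * (?A + ?B - 2 * ?C)\<^sup>2 - 2 * (3 * ?A\<^sup>2) - 2 * (3 * ?B\<^sup>2)) * (1/12))"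
    using h[of "\<lambda>p. c p + d p"] h[of "\<lambda>p. c p - d p"] h[of c] h[of d]
    unfolding plus minus vplus vminus
    by (intro has_bochner_integral_mult_left has_bochner_integral_add has_bochner_integral_diff
        has_bochner_integral_mult_right) auto
  moreover have e1: "((x + y) ^ 4 + (x - y) ^ 4 - 2 * x ^ 4 - 2 * y ^ 4) * (1/12) = x\<^sup>2 * y\<^sup>2" for x y :: real
    by (simp add: algebra_simps power4_eq_xxxx power2_eq_square)
  moreover have e2: "(3 * (A + B + 2 * C)\<^sup>2 + 3 * (A + B - 2 * C)\<^sup>2 - 2 * (3 * A\<^sup>2) - 2 * (3 * B\<^sup>2)) * (1/12)
    = A * B + 2 * C\<^sup>2" for A B C :: real
    by (simp add: algebra_simps power2_eq_square)
  ultimately show ?thesis unfolding e1 e2 by blast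
qed

section \<open>Quadratic forms in a rotated GOE matrix\<close>

definition upper_triangle :: "nat \<Rightarrow> (nat \<times> nat) set" where
  "upper_triangle n = {(a,b). a \<le> b \<and> b < n}"

lemma finite_upper_triangle: "finite (upper_triangle n)"
  by (rule finite_subset[of _ "{..<n} \<times> {..<n}"]) (auto simp: upper_triangle_def)

lemma sum_square_upper_triangle:
  fixes f :: "nat \<Rightarrow> nat \<Rightarrow> real"
  shows "(\<Sum>a<n. \<Sum>b<n. f a b) = (\<Sum>(a,b)\<in>upper_triangle n. if a = b then f a a else f a b + f b a)"
  unfolding upper_triangle_def
proof (induction n)
  case (Suc n)
  have "{(a,b). a \<le> b \<and> b < Suc n} = {(a,b). a \<le> b \<and> b < n} \<union> (\<lambda>a. (a,n)) ` {..n}"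
    by (auto simp: less_Suc_eq)
  moreover have "finite {(a,b). a \<le> b \<and> b < n}"
    by (rule finite_subset[of _ "{..<n} \<times> {..<n}"]) auto
  ultimately have "(\<Sum>(a,b)\<in>{(a,b). a \<le> b \<and> b < Suc n}. if a = b then f a a else f a b + f b a)
    = (\<Sum>a<n. \<Sum>b<n. f a b) + (\<Sum>(a,b)\<in>(\<lambda>a. (a,n)) ` {..n}. if a = b then f a a else f a b + f b a)"
    by (subst Suc) (simp, rule sum.union_disjoint, auto)
  also have "(\<Sum>(a,b)\<in>(\<lambda>a. (a,n)) ` {..n}. if a = b then f a a else f a b + f b a)
     = (\<Sum>a\<le>n. if a = n then f a a else f a n + f n a)"
    by (subst sum.reindex) (auto simp: inj_on_def)
  also have "\<dots> = f n n + (\<Sum>a<n. f a n + f n a)"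
    by (simp add: lessThan_Suc_atMost[symmetric])
  finally show ?case by (simp add: sum.distrib)
qed simp

text \<open>The covariance \<open>\<delta>\<^sub>i\<^sub>k \<delta>\<^sub>j\<^sub>l + \<delta>\<^sub>i\<^sub>l \<delta>\<^sub>j\<^sub>k\<close> of the entries at \<open>p = (i,j)\<close> and \<open>q = (k,l)\<close> of a GOE matrix.\<close>

definition goe_cov :: "nat \<times> nat \<Rightarrow> nat \<times> nat \<Rightarrow> real" where
  "goe_cov p q = of_bool (p = q) + of_bool (p = prod.swap q)"

lemma goe_cov_pair: "goe_cov (i,j) (k,l) = of_bool (i = k \<and> j = l) + of_bool (i = l \<and> j = k)"
  unfolding goe_cov_def prod.inject swap_simp by (rule refl)

lemma goe_cov_diag: "goe_cov (i,j) (i,j) = 1 + of_bool (i = j)"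
  unfolding goe_cov_pair by (cases "i = j") simp_all

lemma goe_cov_bounds: "0 \<le> goe_cov p q" "(goe_cov p q)\<^sup>2 \<le> 2 * goe_cov p q"
  unfolding goe_cov_def by (cases "p = q"; cases "p = prod.swap q"; simp)+

text \<open>The coefficients of \<open>w\<^sub>i \<bullet> Z w\<^sub>j\<close> as a linear form in the independent entries \<open>Z $$ (a,b)\<close> with \<open>a \<le> b\<close>.\<close>

definition rotate_coeff :: "(nat \<Rightarrow> real vec) \<Rightarrow> nat \<times> nat \<Rightarrow> nat \<times> nat \<Rightarrow> real" where
  "rotate_coeff w = (\<lambda>(i,j) (a,b). if a = b then w i $ a * w j $ a else w i $ a * w j $ b + w i $ b * w j $ a)"

definition goe_sd :: "nat \<times> nat \<Rightarrow> real" where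
  "goe_sd = (\<lambda>(a,b). if a = b then sqrt 2 else 1)"

lemma rotated_entry_eq:
  assumes w: "orthonormal_basis n w" and Z: "symmetric_mat n Z" and ij: "i < n" "j < n"
  shows "w i \<bullet> (Z *\<^sub>v w j) = (\<Sum>p\<in>upper_triangle n. rotate_coeff w (i,j) p * Z $$ p)"
proof -
  have ZT: "Z $$ (b,a) = Z $$ (a,b)" if "a < n" "b < n" for a b
    using that symmetric_matD[OF Z] by (metis index_transpose_mat(1))
  have "w i \<bullet> (Z *\<^sub>v w j) = (\<Sum>a<n. \<Sum>b<n. w i $ a * (Z $$ (a,b) * w j $ b))"
    using symmetric_matD(1)[OF Z] orthonormal_basisD(1)[OF w ij(2)]
      mult_mat_vec_lessThan[OF symmetric_matD(1)[OF Z] orthonormal_basisD(1)[OF w ij(2)]]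
    by (simp add: scalar_prod_lessThan[where n=n] sum_distrib_left del: index_mult_mat_vec)
  also have "\<dots> = (\<Sum>p\<in>upper_triangle n. rotate_coeff w (i,j) p * Z $$ p)"
    unfolding sum_square_upper_triangle
    by (intro sum.cong refl) (auto simp: upper_triangle_def rotate_coeff_def ZT algebra_simps)
  finally show ?thesis .
qed

text \<open>Invariance of the GOE covariance under orthogonal rotations. The diagonal variance 2 is what makes
the weighted sum over the upper triangle equal to half the sum over the full square, which factors
into scalar products of the basis vectors.\<close>

lemma rotate_coeff_cov:
  assumes w: "orthonormal_basis n w" and "i < n" "j < n" "k < n" "l < n"
  shows "(\<Sum>p\<in>upper_triangle n. rotate_coeff w (i,j) p * rotate_coeff w (k,l) p * (goe_sd p)\<^sup>2) = goe_cov (i,j) (k,l)"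
proof -
  let ?f = "\<lambda>a b. (w i $ a * w j $ b + w i $ b * w j $ a) * (w k $ a * w l $ b + w k $ b * w l $ a) / 2"
  have prod: "(\<Sum>a<n. \<Sum>b<n. (w i $ a * w k $ a) * (w j $ b * w l $ b)) = of_bool (i = k \<and> j = l)"
    if "i < n" "j < n" "k < n" "l < n" for i j k l
    unfolding sum_product[symmetric]
    using orthonormal_basisD(4)[OF w that(1,3)] orthonormal_basisD(4)[OF w that(2,4)]
      orthonormal_basisD(2)[OF w] that by (simp add: scalar_prod_lessThan[where n=n])
  have e1: "(\<Sum>p\<in>upper_triangle n. rotate_coeff w (i,j) p * rotate_coeff w (k,l) p * (goe_sd p)\<^sup>2) = (\<Sum>a<n. \<Sum>b<n. ?f a b)"
    unfolding sum_square_upper_triangle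
    by (intro sum.cong refl) (auto simp: rotate_coeff_def goe_sd_def field_simps)
  have e2: "(\<Sum>a<n. \<Sum>b<n. ?f a b) = (\<Sum>a<n. \<Sum>b<n. ((w i $ a * w k $ a) * (w j $ b * w l $ b) + (w i $ a * w l $ a) * (w j $ b * w k $ b)
      + (w j $ a * w k $ a) * (w i $ b * w l $ b) + (w j $ a * w l $ a) * (w i $ b * w k $ b)) / 2)"
    by (intro sum.cong refl) (simp add: algebra_simps)
  have "(\<Sum>p\<in>upper_triangle n. rotate_coeff w (i,j) p * rotate_coeff w (k,l) p * (goe_sd p)\<^sup>2) =
      (of_bool (i = k \<and> j = l) + of_bool (i = l \<and> j = k) + of_bool (j = k \<and> i = l) + of_bool (j = l \<and> i = k)) / 2"
    unfolding e1 e2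
    unfolding sum.distrib sum_divide_distrib[symmetric]
      prod[OF assms(2,3,4,5)] prod[OF assms(2,3,5,4)] prod[OF assms(3,2,4,5)] prod[OF assms(3,2,5,4)]
    by (rule refl)
  also have "\<dots> = goe_cov (i,j) (k,l)"
    unfolding goe_cov_pair conj_commute[of "j = k"] conj_commute[of "j = l"] by argo
  finally show ?thesis .
qed

lemma (in prob_space) GOE_rotated_moments:
  assumes goe: "GOE n Z" and w: "orthonormal_basis n w"
  defines "Y \<equiv> \<lambda>p \<omega>. w (fst p) \<bullet> (Z \<omega> *\<^sub>v w (snd p))"
  assumes p: "p \<in> {..<n} \<times> {..<n}" and q: "q \<in> {..<n} \<times> {..<n}"
  shows "has_bochner_integral M (\<lambda>\<omega>. (Y p \<omega>)\<^sup>2) (goe_cov p p)"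
    and "has_bochner_integral M (\<lambda>\<omega>. (Y p \<omega>)\<^sup>2 * (Y q \<omega>)\<^sup>2) (goe_cov p p * goe_cov q q + 2 * (goe_cov p q)\<^sup>2)"
proof -
  obtain i j where pij: "p = (i,j)" "i < n" "j < n" using p by auto
  obtain k l where qkl: "q = (k,l)" "k < n" "l < n" using q by auto
  have sym: "symmetric_mat n (Z \<omega>)" if "\<omega> \<in> space M" for \<omega> using goe that by (auto simp: GOE_def)
  have ind: "indep_vars (\<lambda>_. borel) (\<lambda>p \<omega>. Z \<omega> $$ p) (upper_triangle n)"
    using goe unfolding GOE_def upper_triangle_def by blast
  have dist: "distributed M lborel (\<lambda>\<omega>. Z \<omega> $$ r) (normal_density 0 (goe_sd r))" if "r \<in> upper_triangle n" for r
    using goe that by (auto simp: GOE_def goe_sd_def upper_triangle_def)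
  have sd: "0 < goe_sd r" if "r \<in> upper_triangle n" for r by (auto simp: goe_sd_def split: prod.split)
  note mom = finite_upper_triangle[of n] ind dist sd
  have sq: "(\<Sum>p\<in>upper_triangle n. (rotate_coeff w (i,j) p * goe_sd p)\<^sup>2) = goe_cov (i,j) (i,j)" if "i < n" "j < n" for i j
    using rotate_coeff_cov[OF w that that] by (simp add: power2_eq_square mult_ac)
  have "has_bochner_integral M (\<lambda>\<omega>. (\<Sum>r\<in>upper_triangle n. rotate_coeff w p r * Z \<omega> $$ r)\<^sup>2) (goe_cov p p)"
    using gaussian_sum_moments(3,4)[OF mom, of "rotate_coeff w (i,j)"]
    unfolding pij(1) sq[OF pij(2,3)] has_bochner_integral_iff by blast
  then show "has_bochner_integral M (\<lambda>\<omega>. (Y p \<omega>)\<^sup>2) (goe_cov p p)"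
    by (rule has_bochner_integral_cong[THEN iffD1, OF refl _ refl, rotated])
       (use rotated_entry_eq[OF w sym pij(2,3)] in \<open>simp add: Y_def pij\<close>)
  have "has_bochner_integral M (\<lambda>\<omega>. (\<Sum>r\<in>upper_triangle n. rotate_coeff w p r * Z \<omega> $$ r)\<^sup>2 *
     (\<Sum>r\<in>upper_triangle n. rotate_coeff w q r * Z \<omega> $$ r)\<^sup>2) (goe_cov p p * goe_cov q q + 2 * (goe_cov p q)\<^sup>2)"
    using gaussian_sum_squares_moment[OF mom, of "rotate_coeff w (i,j)" "rotate_coeff w (k,l)"]
    unfolding pij(1) qkl(1) sq[OF pij(2,3)] sq[OF qkl(2,3)] rotate_coeff_cov[OF w pij(2,3) qkl(2,3)] .
  then show "has_bochner_integral M (\<lambda>\<omega>. (Y p \<omega>)\<^sup>2 * (Y q \<omega>)\<^sup>2) (goe_cov p p * goe_cov q q + 2 * (goe_cov p q)\<^sup>2)"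
    by (rule has_bochner_integral_cong[THEN iffD1, OF refl _ refl, rotated])
       (use rotated_entry_eq[OF w sym pij(2,3)] rotated_entry_eq[OF w sym qkl(2,3)] in \<open>simp add: Y_def pij qkl\<close>)
qed

text \<open>By the Gaussian moment formula, the squares \<open>(w\<^sub>i \<bullet> Z w\<^sub>j)\<^sup>2\<close> at \<open>p = (i,j)\<close> and \<open>q = (k,l)\<close> have covariance
\<open>2 (goe_cov p q)\<^sup>2\<close>, which vanishes unless \<open>q\<close> is \<open>p\<close> or its reflection. Of the \<open>n\<^sup>4\<close> terms of the variance
only \<open>O(n\<^sup>2)\<close> survive.\<close>

lemma (in prob_space) GOE_quadratic_variance:
  assumes goe: "GOE n Z" and w: "orthonormal_basis n w"
    and G: "\<And>i j. i < n \<Longrightarrow> j < n \<Longrightarrow> \<bar>G i j\<bar> \<le> K"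
  defines "Q \<equiv> \<lambda>\<omega>. \<Sum>i<n. \<Sum>j<n. G i j * (w i \<bullet> (Z \<omega> *\<^sub>v w j))\<^sup>2"
    and "m \<equiv> (\<Sum>i<n. \<Sum>j<n. G i j) + (\<Sum>i<n. G i i)"
  shows "has_bochner_integral M Q m"
    and "integrable M (\<lambda>\<omega>. (Q \<omega> - m)\<^sup>2)"
    and "expectation (\<lambda>\<omega>. (Q \<omega> - m)\<^sup>2) \<le> 8 * K\<^sup>2 * (real n)\<^sup>2"
proof -
  let ?S = "{..<n} \<times> {..<n}"
  define Y where "Y = (\<lambda>p \<omega>. w (fst p) \<bullet> (Z \<omega> *\<^sub>v w (snd p)))"
  define g where "g = (\<lambda>p. G (fst p) (snd p))"
  have m1: "has_bochner_integral M (\<lambda>\<omega>. (Y p \<omega>)\<^sup>2) (goe_cov p p)" if "p \<in> ?S" for p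
    unfolding Y_def by (rule GOE_rotated_moments(1)[OF goe w that that])
  have m2: "has_bochner_integral M (\<lambda>\<omega>. (Y p \<omega>)\<^sup>2 * (Y q \<omega>)\<^sup>2) (goe_cov p p * goe_cov q q + 2 * (goe_cov p q)\<^sup>2)"
    if "p \<in> ?S" "q \<in> ?S" for p q
    unfolding Y_def by (rule GOE_rotated_moments(2)[OF goe w that])
  have Q: "Q = (\<lambda>\<omega>. \<Sum>p\<in>?S. g p * (Y p \<omega>)\<^sup>2)"
    by (auto simp: Q_def g_def Y_def sum.cartesian_product split_beta)
  have "m = (\<Sum>i<n. \<Sum>j<n. G i j * (1 + of_bool (i = j)))"
  proof -
    have "(\<Sum>j<n. G i j * (1 + of_bool (i = j))) = (\<Sum>j<n. G i j) + G i i" if "i < n" for i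
      using that by (simp add: sum.distrib distrib_left of_bool_def if_distrib[of "\<lambda>x. _ * x"] cong: if_cong)
    then show ?thesis by (simp add: m_def sum.distrib)
  qed
  also have "\<dots> = (\<Sum>p\<in>?S. g p * goe_cov p p)"
    unfolding sum.cartesian_product
    by (rule sum.cong[OF refl]) (clarsimp simp: g_def goe_cov_diag)
  finally have m: "m = (\<Sum>p\<in>?S. g p * goe_cov p p)" .
  show "has_bochner_integral M Q m"
    unfolding Q m by (intro has_bochner_integral_sum has_bochner_integral_mult_right m1)
  let ?D = "\<lambda>p \<omega>. (Y p \<omega>)\<^sup>2 - goe_cov p p"
  have D: "has_bochner_integral M (\<lambda>\<omega>. ?D p \<omega> * ?D q \<omega>) (2 * (goe_cov p q)\<^sup>2)" if "p \<in> ?S" "q \<in> ?S" for p q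
  proof -
    have "has_bochner_integral M (\<lambda>\<omega>. (Y p \<omega>)\<^sup>2 * (Y q \<omega>)\<^sup>2 - goe_cov p p * (Y q \<omega>)\<^sup>2 - goe_cov q q * (Y p \<omega>)\<^sup>2 + goe_cov p p * goe_cov q q)
       ((goe_cov p p * goe_cov q q + 2 * (goe_cov p q)\<^sup>2) - goe_cov p p * goe_cov q q - goe_cov q q * goe_cov p p + goe_cov p p * goe_cov q q)"
      by (intro has_bochner_integral_add has_bochner_integral_diff has_bochner_integral_mult_right
          m1 m2 that) (simp add: has_bochner_integral_iff prob_space)
    moreover have "a * b - c * b - d * a + c * d = (a - c) * (b - d)" for a b c d :: real
      by (simp add: algebra_simps)
    ultimately show ?thesis by simp
  qed
  have sq: "(Q \<omega> - m)\<^sup>2 = (\<Sum>p\<in>?S. \<Sum>q\<in>?S. g p * g q * (?D p \<omega> * ?D q \<omega>))" for \<omega>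
  proof -
    have "Q \<omega> - m = (\<Sum>p\<in>?S. g p * ?D p \<omega>)"
      by (simp add: Q m sum_subtractf right_diff_distrib)
    then have "(Q \<omega> - m)\<^sup>2 = (\<Sum>p\<in>?S. \<Sum>q\<in>?S. (g p * ?D p \<omega>) * (g q * ?D q \<omega>))"
      by (simp only: power2_eq_square sum_product)
    then show ?thesis by (simp only: mult.assoc mult.left_commute)
  qed
  have V: "has_bochner_integral M (\<lambda>\<omega>. (Q \<omega> - m)\<^sup>2) (\<Sum>p\<in>?S. \<Sum>q\<in>?S. g p * g q * (2 * (goe_cov p q)\<^sup>2))"
    unfolding sq by (intro has_bochner_integral_sum has_bochner_integral_mult_right D)
  then show "integrable M (\<lambda>\<omega>. (Q \<omega> - m)\<^sup>2)" by (rule integrable.intros)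
  have K: "\<bar>g p\<bar> \<le> K" if "p \<in> ?S" for p using G that by (auto simp: g_def)
  have ksum: "(\<Sum>q\<in>?S. goe_cov p q) = 2" if "p \<in> ?S" for p
  proof -
    have "(\<Sum>q\<in>?S. of_bool (p = prod.swap q)) = (\<Sum>q\<in>?S. if q = prod.swap p then 1 else (0::real))"
      by (rule sum.cong[OF refl]) auto
    moreover have "prod.swap p \<in> ?S" using that by auto
    moreover have "(\<Sum>q\<in>?S. of_bool (p = q)) = (1::real)"
      using that by (simp add: of_bool_def del: mem_Sigma_iff)
    ultimately show ?thesis by (simp add: goe_cov_def sum.distrib del: mem_Sigma_iff)
  qed
  have "(\<Sum>p\<in>?S. \<Sum>q\<in>?S. g p * g q * (2 * (goe_cov p q)\<^sup>2)) \<le> (\<Sum>p\<in>?S. \<Sum>q\<in>?S. K\<^sup>2 * (4 * goe_cov p q))"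
  proof (intro sum_mono)
    fix p q assume pq: "p \<in> ?S" "q \<in> ?S"
    have "g p * g q \<le> \<bar>g p\<bar> * \<bar>g q\<bar>" by (simp add: abs_mult[symmetric])
    also have "\<dots> \<le> K * K" using K[OF pq(1)] K[OF pq(2)] by (intro mult_mono) auto
    finally have "g p * g q \<le> K\<^sup>2" by (simp add: power2_eq_square)
    moreover have "2 * (goe_cov p q)\<^sup>2 \<le> 4 * goe_cov p q" using goe_cov_bounds(2)[of p q] by simp
    ultimately show "g p * g q * (2 * (goe_cov p q)\<^sup>2) \<le> K\<^sup>2 * (4 * goe_cov p q)"
      by (rule mult_mono) simp_all
  qed
  also have "\<dots> = (\<Sum>p\<in>?S. K\<^sup>2 * (4 * (\<Sum>q\<in>?S. goe_cov p q)))"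
    by (simp add: sum_distrib_left)
  also have "\<dots> = (\<Sum>p\<in>?S. 8 * K\<^sup>2)" using ksum by (intro sum.cong refl) simp
  also have "\<dots> = 8 * K\<^sup>2 * (real n)\<^sup>2" by (simp add: power2_eq_square)
  finally show "expectation (\<lambda>\<omega>. (Q \<omega> - m)\<^sup>2) \<le> 8 * K\<^sup>2 * (real n)\<^sup>2"
    using V by (simp add: has_bochner_integral_iff)
qed

section \<open>Divided differences and weak convergence\<close>

lemma C1_derivative:
  assumes "h C1_differentiable_on UNIV"
  shows "(h has_real_derivative deriv h x) (at x)" and "isCont (deriv h) x"
proof -
  from assms obtain D where D: "\<And>x. (h has_vector_derivative D x) (at x)" "continuous_on UNIV D"
    by (auto simp: C1_differentiable_on_def)
  have der: "(h has_real_derivative D x) (at x)" for x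
    using D(1) by (simp add: has_real_derivative_iff_has_vector_derivative)
  then have "deriv h = D" using DERIV_imp_deriv by blast
  then show "(h has_real_derivative deriv h x) (at x)" "isCont (deriv h) x"
    using der D(2) by (auto simp: continuous_on_eq_continuous_at)
qed

text \<open>Off the diagonal this is continuity of a quotient. At a diagonal point, the mean value theorem
replaces a nearby divided difference by a value of the continuous derivative.\<close>

lemma isCont_divdiff_joint:
  assumes h: "h C1_differentiable_on UNIV"
  shows "isCont (\<lambda>(s,t). divdiff h s t) p"
proof -
  obtain s0 t0 where p: "p = (s0,t0)" by (cases p)
  note der = C1_derivative[OF h]
  have hc: "isCont h x" for x using der(1) DERIV_isCont by blast
  show ?thesis
  proof (cases "s0 = t0")
    case False
    have "open {q::real\<times>real. fst q \<noteq> snd q}"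
      by (intro open_Collect_neq continuous_intros)
    then have ev: "\<forall>\<^sub>F q in nhds p. fst q \<noteq> snd q"
      using eventually_nhds_in_open[of "{q. fst q \<noteq> snd q}" p] False p by simp
    have "isCont (\<lambda>q. (h (snd q) - h (fst q)) / (snd q - fst q)) p"
      using False p hc by (intro continuous_intros isCont_o2[OF _ hc]) auto
    moreover have eq: "\<forall>\<^sub>F q in nhds p. (case q of (s,t) \<Rightarrow> divdiff h s t) = (h (snd q) - h (fst q)) / (snd q - fst q)"
      using ev by eventually_elim (auto simp: divdiff_def)
    ultimately show ?thesis using isCont_cong[OF eq] by simp
  next
    case True
    show ?thesis
      unfolding continuous_at_eps_delta
    proof (intro allI impI)
      fix e :: real assume "e > 0"
      then obtain d where d: "d > 0" "\<And>x. dist x s0 < d \<Longrightarrow> dist (deriv h x) (deriv h s0) < e"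
        using der(2)[of s0] unfolding continuous_at_eps_delta by blast
      have "dist (divdiff h s t) (deriv h s0) < e" if "dist (s,t) p < d" for s t
      proof -
        have st: "dist s s0 < d" "dist t s0 < d"
          using that dist_fst_le[of "(s,t)" p] dist_snd_le[of "(s,t)" p] p True by auto
        have "\<exists>x. dist x s0 < d \<and> divdiff h s t = deriv h x"
        proof (cases "s = t")
          case True
          then show ?thesis using st by (auto simp: divdiff_def)
        next
          case False
          have mvt: "\<exists>x. min s t < x \<and> x < max s t \<and> h (max s t) - h (min s t) = (max s t - min s t) * deriv h x"
            using False by (intro MVT2 der(1)) auto
          then obtain x where x: "min s t < x" "x < max s t"
            "h (max s t) - h (min s t) = (max s t - min s t) * deriv h x" by blast
          have "divdiff h s t = (h (max s t) - h (min s t)) / (max s t - min s t)"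
            using False minus_divide_divide[of "h s - h t" "s - t"]
            by (cases "s \<le> t") (simp_all add: divdiff_def)
          also have "\<dots> = deriv h x" unfolding x(3) using False by (auto simp: min_def max_def)
          finally have "divdiff h s t = deriv h x" .
          moreover have "dist x s0 < d"
            using x(1,2) st by (auto simp: dist_real_def min_def max_def abs_if split: if_splits)
          ultimately show ?thesis by blast
        qed
        then show ?thesis using d(2) by auto
      qed
      then have "\<forall>q. dist q p < d \<longrightarrow> dist (case q of (s,t) \<Rightarrow> divdiff h s t) (case p of (s,t) \<Rightarrow> divdiff h s t) < e"
        using p True by (auto simp: divdiff_def)
      then show "\<exists>d>0. \<forall>q. dist q p < d \<longrightarrow> dist (case q of (s,t) \<Rightarrow> divdiff h s t) (case p of (s,t) \<Rightarrow> divdiff h s t) < e"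
        using d(1) by blast
    qed
  qed
qed

lemma isCont_divdiff: "h C1_differentiable_on UNIV \<Longrightarrow> isCont (divdiff h s) t"
  using isCont_o2[where f="\<lambda>t. (s,t)" and g="\<lambda>(s,t). divdiff h s t" and a=t]
    isCont_divdiff_joint[of h "(s,t)"] by (simp add: continuous_Pair)

text \<open>Skorohod's theorem realises the weak convergence by pointwise convergent random variables; bounded
convergence then applies twice, first to the inner and then to the outer integral.\<close>

lemma weak_conv_double_integral:
  fixes G :: "real \<times> real \<Rightarrow> real"
  assumes mu: "\<And>n. real_distribution (\<mu> n)" and H: "real_distribution H"
    and conv: "weak_conv_m \<mu> H"
    and G: "continuous_on UNIV G" and B: "\<And>p. \<bar>G p\<bar> \<le> B"
  shows "(\<lambda>n. \<integral>s. (\<integral>t. G (s,t) \<partial>\<mu> n) \<partial>\<mu> n) \<longlonglongrightarrow> (\<integral>s. (\<integral>t. G (s,t) \<partial>H) \<partial>H)"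
proof -
  from Skorohod[OF mu H conv] obtain \<Omega> :: "real measure" and X Y where \<Omega>: "prob_space \<Omega>"
    and XY: "\<forall>n. X n \<in> measurable \<Omega> borel" "\<forall>n. distr \<Omega> borel (X n) = \<mu> n"
      "Y \<in> measurable \<Omega> lborel" "distr \<Omega> borel Y = H"
      "\<forall>x\<in>space \<Omega>. (\<lambda>n. X n x) \<longlonglongrightarrow> Y x"
    by (elim exE conjE) (rule that)
  have X: "\<And>n. X n \<in> measurable \<Omega> borel" "\<And>n. distr \<Omega> borel (X n) = \<mu> n"
    and Y: "Y \<in> measurable \<Omega> borel" "distr \<Omega> borel Y = H"
    and lim: "\<And>x. x \<in> space \<Omega> \<Longrightarrow> (\<lambda>n. X n x) \<longlonglongrightarrow> Y x"
    using XY by simp_all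
  interpret prob_space \<Omega> by (rule \<Omega>)
  note [measurable] = X(1) Y(1)
  have Gm [measurable]: "G \<in> borel_measurable (borel \<Otimes>\<^sub>M borel)"
    using borel_measurable_continuous_onI[OF G] by (simp add: borel_prod)
  have push: "(\<integral>s. (\<integral>t. G (s,t) \<partial>distr \<Omega> borel V) \<partial>distr \<Omega> borel V) = (\<integral>x. (\<integral>y. G (V x, V y) \<partial>\<Omega>) \<partial>\<Omega>)"
    if [measurable]: "V \<in> measurable \<Omega> borel" for V
  proof -
    have "(\<integral>s. (\<integral>t. G (s,t) \<partial>distr \<Omega> borel V) \<partial>distr \<Omega> borel V) = (\<integral>s. (\<integral>y. G (s, V y) \<partial>\<Omega>) \<partial>distr \<Omega> borel V)"
      by (intro Bochner_Integration.integral_cong refl integral_distr) simp_all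
    also have "\<dots> = (\<integral>x. (\<integral>y. G (V x, V y) \<partial>\<Omega>) \<partial>\<Omega>)"
      by (intro integral_distr) simp_all
    finally show ?thesis .
  qed
  have bnd: "\<bar>\<integral>y. G (a, V y) \<partial>\<Omega>\<bar> \<le> B" if [measurable]: "V \<in> measurable \<Omega> borel" for V a
  proof -
    have "integrable \<Omega> (\<lambda>y. G (a, V y))" using B by (intro integrable_const_bound[of _ B]) auto
    then have "(\<integral>y. G (a, V y) \<partial>\<Omega>) \<le> B" "- B \<le> (\<integral>y. G (a, V y) \<partial>\<Omega>)"
      using B by (auto intro!: integral_le_const integral_ge_const simp: abs_le_iff minus_le_iff)
    then show ?thesis by (simp add: abs_le_iff)
  qed
  have tend: "(\<lambda>n. G (X n x, X n y)) \<longlonglongrightarrow> G (Y x, Y y)" if "x \<in> space \<Omega>" "y \<in> space \<Omega>" for x y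
    using continuous_on_tendsto_compose[OF G tendsto_Pair[OF lim[OF that(1)] lim[OF that(2)]]] by simp
  have inner: "(\<lambda>n. \<integral>y. G (X n x, X n y) \<partial>\<Omega>) \<longlonglongrightarrow> (\<integral>y. G (Y x, Y y) \<partial>\<Omega>)" if "x \<in> space \<Omega>" for x
    by (rule integral_dominated_convergence[where w="\<lambda>_. B"]) (use tend that B in auto)
  have "(\<lambda>n. \<integral>x. (\<integral>y. G (X n x, X n y) \<partial>\<Omega>) \<partial>\<Omega>) \<longlonglongrightarrow> (\<integral>x. (\<integral>y. G (Y x, Y y) \<partial>\<Omega>) \<partial>\<Omega>)"
    by (rule integral_dominated_convergence[where w="\<lambda>_. B"]) (use inner bnd X(1) Y(1) in auto)
  then show ?thesis using push[OF X(1)] push[OF Y(1)] by (simp add: X(2) Y(2))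
qed

lemma esd_real_distribution:
  assumes "n \<ge> 1"
  shows "real_distribution (esd n A)"
proof -
  interpret prob_space "uniform_count_measure {..<n}"
    using assms by (intro prob_space_uniform_count_measure) (auto simp: lessThan_empty_iff)
  have "prob_space (esd n A)"
    unfolding esd_def by (intro prob_space_distr) (simp add: measurable_def space_uniform_count_measure sets_uniform_count_measure)
  then show ?thesis by (simp add: real_distribution_def real_distribution_axioms_def esd_def)
qed

lemma integral_esd:
  fixes f :: "real \<Rightarrow> real"
  assumes "n \<ge> 1" and [measurable]: "f \<in> borel_measurable borel"
  shows "(\<integral>x. f x \<partial>esd n A) = (\<Sum>i<n. f (eigvals_desc A ! i)) / real n"
proof -
  have "(\<integral>x. f x \<partial>esd n A) = (\<integral>i. f (eigvals_desc A ! i) \<partial>uniform_count_measure {..<n})"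
    unfolding esd_def
    by (intro integral_distr assms(2)) (simp add: measurable_def space_uniform_count_measure sets_uniform_count_measure)
  then show ?thesis by (simp add: integral_uniform_count_measure)
qed

definition clamp_to :: "real \<Rightarrow> real \<Rightarrow> real \<Rightarrow> real" where
  "clamp_to c d x = max c (min d x)"

text \<open>Divided differences need not be bounded on the whole plane. Clamping the arguments to an interval
that carries the spectra makes the kernel bounded without changing the values that occur.\<close>

lemma divdiff_clamped:
  assumes h: "h C1_differentiable_on UNIV" and "c \<le> d"
  defines "G \<equiv> \<lambda>p. (divdiff h (clamp_to c d (fst p)) (clamp_to c d (snd p)))\<^sup>2"
  shows "continuous_on UNIV G" and "\<exists>B. \<forall>p. \<bar>G p\<bar> \<le> B"
proof -
  have c: "continuous_on UNIV (\<lambda>(s,t). divdiff h s t)"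
    using isCont_divdiff_joint[OF h] by (simp add: continuous_at_imp_continuous_on)
  have cl: "continuous_on UNIV (\<lambda>p::real\<times>real. (clamp_to c d (fst p), clamp_to c d (snd p)))"
    unfolding clamp_to_def by (intro continuous_intros)
  have "continuous_on UNIV (\<lambda>p. case (clamp_to c d (fst p), clamp_to c d (snd p)) of (s,t) \<Rightarrow> divdiff h s t)"
    by (rule continuous_on_compose2[OF c cl]) simp
  then show "continuous_on UNIV G" unfolding G_def by (intro continuous_on_power) simp
  have "compact ((\<lambda>(s,t). divdiff h s t) ` ({c..d} \<times> {c..d}))"
    by (intro compact_continuous_image continuous_on_subset[OF c] compact_Times) auto
  then obtain B where B: "\<And>s t. s \<in> {c..d} \<Longrightarrow> t \<in> {c..d} \<Longrightarrow> \<bar>divdiff h s t\<bar> \<le> B"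
    by (force dest: compact_imp_bounded simp: bounded_iff)
  have "\<bar>G p\<bar> \<le> B\<^sup>2" for p
  proof -
    have "\<bar>divdiff h (clamp_to c d (fst p)) (clamp_to c d (snd p))\<bar> \<le> B"
      using assms(2) by (intro B) (auto simp: clamp_to_def)
    then show ?thesis unfolding G_def by (metis abs_ge_zero abs_power2 power2_abs power_mono)
  qed
  then show "\<exists>B. \<forall>p. \<bar>G p\<bar> \<le> B" by blast
qed

lemma clamp_to_id: "x \<in> {c..d} \<Longrightarrow> clamp_to c d x = x"
  by (auto simp: clamp_to_def)

section \<open>Measurability of spectral functions\<close>

lemma space_borel_mat [simp]: "space (borel_mat n) = carrier_mat n n"
  by (simp add: borel_mat_def)

lemma measurable_entry:
  assumes "i < n" "j < n"
  shows "(\<lambda>A. A $$ (i,j)) \<in> borel_measurable (borel_mat n)"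
proof -
  let ?f = "\<lambda>A::real mat. \<lambda>p\<in>{..<n} \<times> {..<n}. A $$ p"
  have "?f \<in> measurable (borel_mat n) (Pi\<^sub>M ({..<n} \<times> {..<n}) (\<lambda>_. borel))"
    unfolding borel_mat_def by (rule measurable_vimage_algebra1) (auto simp: space_PiM)
  from measurable_compose[OF this measurable_component_singleton[of "(i,j)"]] assms
  show ?thesis by simp
qed

lemma measurable_borel_matI:
  assumes "\<And>x. x \<in> space N \<Longrightarrow> f x \<in> carrier_mat n n"
    and "\<And>i j. i < n \<Longrightarrow> j < n \<Longrightarrow> (\<lambda>x. f x $$ (i,j)) \<in> borel_measurable N"
  shows "f \<in> measurable N (borel_mat n)"
  unfolding borel_mat_def
proof (rule measurable_vimage_algebra2)
  show "(\<lambda>x. \<lambda>p\<in>{..<n} \<times> {..<n}. f x $$ p) \<in> measurable N (Pi\<^sub>M ({..<n} \<times> {..<n}) (\<lambda>_. borel))"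
    by (rule measurable_restrict) (use assms(2) in auto)
qed (use assms(1) in auto)

lemma measurable_pow_mat:
  assumes "i < n" "j < n"
  shows "(\<lambda>A. (A ^\<^sub>m k) $$ (i,j)) \<in> borel_measurable (borel_mat n)"
  using assms
proof (induction k arbitrary: i j)
  case 0
  have "(\<lambda>A. (A ^\<^sub>m 0) $$ (i,j)) \<in> borel_measurable (borel_mat n) \<longleftrightarrow>
      (\<lambda>A. if i = j then 1 else 0 :: real) \<in> borel_measurable (borel_mat n)"
    by (rule measurable_cong) (use 0 in auto)
  then show ?case by simp
next
  case (Suc k)
  have "(\<lambda>A. (A ^\<^sub>m Suc k) $$ (i,j)) \<in> borel_measurable (borel_mat n) \<longleftrightarrow>
      (\<lambda>A. \<Sum>l<n. (A ^\<^sub>m k) $$ (i,l) * A $$ (l,j)) \<in> borel_measurable (borel_mat n)"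
  proof (rule measurable_cong)
    fix A :: "real mat" assume "A \<in> space (borel_mat n)"
    then have "A \<in> carrier_mat n n" "A ^\<^sub>m k \<in> carrier_mat n n" by simp_all
    then show "(A ^\<^sub>m Suc k) $$ (i,j) = (\<Sum>l<n. (A ^\<^sub>m k) $$ (i,l) * A $$ (l,j))"
      using Suc.prems by (simp add: scalar_prod_def atLeast0LessThan)
  qed
  moreover have "(\<lambda>A. \<Sum>l<n. (A ^\<^sub>m k) $$ (i,l) * A $$ (l,j)) \<in> borel_measurable (borel_mat n)"
    using Suc by (intro borel_measurable_sum borel_measurable_times measurable_entry) auto
  ultimately show ?case by blast
qed

text \<open>Monomials in \<open>A\<close> agree with the functional calculus; they are the functions for which measurability in
\<open>A\<close> is evident.\<close>

lemma pow_mat_entry: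
  assumes A: "symmetric_mat n A" and "r < n" "c < n"
  shows "(A ^\<^sub>m k) $$ (r,c) = (\<Sum>i<n. (eigvals_desc A ! i) ^ k * (eigbasis A i $ r * eigbasis A i $ c))"
proof -
  let ?u = "eigbasis A"
  note u = eigbasis_orthonormal[OF A]
  have Ac: "A \<in> carrier_mat n n" using symmetric_matD[OF A] by simp
  have pc: "A ^\<^sub>m k \<in> carrier_mat n n" for k using Ac by simp
  have ev: "(A ^\<^sub>m k) *\<^sub>v ?u i = (eigvals_desc A ! i) ^ k \<cdot>\<^sub>v ?u i" if i: "i < n" for i k
  proof (induction k)
    case 0
    show ?case using Ac orthonormal_basisD(1)[OF u i] by simp
  next
    case (Suc k)
    have "(A ^\<^sub>m Suc k) *\<^sub>v ?u i = (A ^\<^sub>m k) *\<^sub>v (A *\<^sub>v ?u i)"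
      using assoc_mult_mat_vec[OF pc[of k] Ac orthonormal_basisD(1)[OF u i]] by simp
    also have "\<dots> = (eigvals_desc A ! i) \<cdot>\<^sub>v ((A ^\<^sub>m k) *\<^sub>v ?u i)"
      using eigenbasis_orthonormal(2)[OF A eigbasis[OF A] i] mult_mat_vec[OF pc[of k] orthonormal_basisD(1)[OF u i]] by simp
    finally show ?case using Suc by (simp add: smult_smult_assoc)
  qed
  have "(A ^\<^sub>m k) $$ (r,c) = (\<Sum>b<n. (A ^\<^sub>m k) $$ (r,b) * (if b = c then 1 else 0))"
    using assms(3) by (simp add: if_distrib[of "\<lambda>x. _ * x"] cong: if_cong)
  also have "\<dots> = (\<Sum>b<n. (A ^\<^sub>m k) $$ (r,b) * (\<Sum>i<n. ?u i $ b * ?u i $ c))"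
    using orthonormal_basis_complete[OF u _ assms(3)] by (intro sum.cong) auto
  also have "\<dots> = (\<Sum>i<n. (\<Sum>b<n. (A ^\<^sub>m k) $$ (r,b) * ?u i $ b) * ?u i $ c)"
    unfolding sum_distrib_left sum_distrib_right by (subst sum.swap) (simp only: mult.assoc)
  also have "\<dots> = (\<Sum>i<n. (eigvals_desc A ! i) ^ k * (?u i $ r * ?u i $ c))"
  proof (rule sum.cong[OF refl])
    fix i assume "i \<in> {..<n}"
    then have i: "i < n" by simp
    have "(\<Sum>b<n. (A ^\<^sub>m k) $$ (r,b) * ?u i $ b) = ((A ^\<^sub>m k) *\<^sub>v ?u i) $ r"
      using mult_mat_vec_lessThan[OF pc[of k] orthonormal_basisD(1)[OF u i] assms(2)] by simp
    also have "\<dots> = (eigvals_desc A ! i) ^ k * ?u i $ r"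
      unfolding ev[OF i] using assms(2) orthonormal_basisD(2)[OF u i] by simp
    finally show "(\<Sum>b<n. (A ^\<^sub>m k) $$ (r,b) * ?u i $ b) * ?u i $ c
        = (eigvals_desc A ! i) ^ k * (?u i $ r * ?u i $ c)" by simp
  qed
  finally show ?thesis .
qed

text \<open>By Stone-Weierstrass there are polynomials that approximate \<open>h\<close> to within \<open>1 / (k + 1)\<close> on \<open>[-k, k]\<close>.
They converge to \<open>h\<close> at every point, so they converge on the spectrum of any symmetric matrix and
not only of those with spectrum in a prescribed interval. The functional calculus is unspecified for matrices that are not
symmetric; the function \<open>F\<close> is a version of it that is measurable on the whole space.\<close>

lemma mat_fun_measurable:
  fixes h :: "real \<Rightarrow> real"
  assumes h: "continuous_on UNIV h"
  shows "\<exists>F. (\<forall>r<n. \<forall>c<n. (\<lambda>A. F A (r,c)) \<in> borel_measurable (borel_mat n)) \<and>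
     (\<forall>A r c. symmetric_mat n A \<longrightarrow> r < n \<longrightarrow> c < n \<longrightarrow> F A (r,c) = mat_fun h A $$ (r,c))"
proof -
  have "\<exists>a N. \<forall>x\<in>{-real k..real k}. \<bar>h x - (\<Sum>i\<le>N. a i * x ^ i)\<bar> < 1 / real (Suc k)" for k :: nat
  proof -
    have "compact {-real k..real k}" "continuous_on {-real k..real k} h" "0 < 1 / real (Suc k)"
      using h continuous_on_subset by auto
    from Stone_Weierstrass_real_polynomial_function[OF this] obtain g where
      g: "real_polynomial_function g" "\<And>x. x \<in> {-real k..real k} \<Longrightarrow> \<bar>h x - g x\<bar> < 1 / real (Suc k)"
      by blast
    then show ?thesis using real_polynomial_function_iff_sum[of g] by fastforce
  qed
  then obtain a :: "nat \<Rightarrow> nat \<Rightarrow> real" and N where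
    aN: "\<And>k x. x \<in> {-real k..real k} \<Longrightarrow> \<bar>h x - (\<Sum>i\<le>N k. a k i * x ^ i)\<bar> < 1 / real (Suc k)"
    by metis
  let ?P = "\<lambda>k x. \<Sum>i\<le>N k. a k i * x ^ i"
  define Q where "Q k A p = (\<Sum>i\<le>N k. a k i * (A ^\<^sub>m i) $$ p)" for k and A :: "real mat" and p
  define F where "F A p = lim (\<lambda>k. Q k A p)" for A p
  have P: "(\<lambda>k. ?P k x) \<longlonglongrightarrow> h x" for x
  proof -
    have "(\<lambda>k. h x - ?P k x) \<longlonglongrightarrow> 0"
    proof (rule Lim_null_comparison)
      obtain m :: nat where m: "\<bar>x\<bar> \<le> real m" using real_arch_simple by blast
      have "norm (h x - ?P k x) \<le> inverse (real (Suc k))" if "k \<ge> m" for k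
      proof -
        have "x \<in> {-real k..real k}" using m that by (auto simp: abs_le_iff)
        then show ?thesis using aN[of x k] by (simp add: inverse_eq_divide)
      qed
      then show "\<forall>\<^sub>F k in sequentially. norm (h x - ?P k x) \<le> inverse (real (Suc k))"
        using eventually_sequentially by blast
    qed (rule LIMSEQ_inverse_real_of_nat)
    from tendsto_diff[OF tendsto_const[of "h x"] this] show ?thesis by simp
  qed
  have "F A (r,c) = mat_fun h A $$ (r,c)" if A: "symmetric_mat n A" and rc: "r < n" "c < n" for A r c
  proof -
    have "Q k A (r,c) = (\<Sum>j<n. ?P k (eigvals_desc A ! j) * (eigbasis A j $ r * eigbasis A j $ c))" for k
    proof -
      have "Q k A (r,c) = (\<Sum>i\<le>N k. \<Sum>j<n. a k i * (eigvals_desc A ! j) ^ i * (eigbasis A j $ r * eigbasis A j $ c))"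
        unfolding Q_def pow_mat_entry[OF A rc] sum_distrib_left by (simp only: mult.assoc)
      also have "\<dots> = (\<Sum>j<n. \<Sum>i\<le>N k. a k i * (eigvals_desc A ! j) ^ i * (eigbasis A j $ r * eigbasis A j $ c))"
        by (rule sum.swap)
      finally show ?thesis by (simp only: sum_distrib_right)
    qed
    moreover have "(\<lambda>k. \<Sum>j<n. ?P k (eigvals_desc A ! j) * (eigbasis A j $ r * eigbasis A j $ c)) \<longlonglongrightarrow>
        (\<Sum>j<n. h (eigvals_desc A ! j) * (eigbasis A j $ r * eigbasis A j $ c))"
      by (intro tendsto_sum tendsto_mult P tendsto_const)
    ultimately show ?thesis unfolding F_def mat_fun_entry[OF A rc] by (intro limI) simp
  qed
  moreover have "(\<lambda>A. F A (r,c)) \<in> borel_measurable (borel_mat n)" if "r < n" "c < n" for r c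
    unfolding F_def Q_def
    by (intro borel_measurable_lim_metric borel_measurable_sum borel_measurable_times
        borel_measurable_const measurable_pow_mat that)
  ultimately show ?thesis by (intro exI[of _ F]) blast
qed

text \<open>If \<open>f(x)\<close> is the distance from \<open>x\<close> to the interval, the trace of \<open>f(A)\<close> vanishes exactly when all
eigenvalues lie in the interval.\<close>

lemma spectrum_in_interval_measurable:
  "\<exists>S\<in>sets (borel_mat n). \<forall>A. symmetric_mat n A \<longrightarrow> (A \<in> S \<longleftrightarrow> set (eigvals_desc A) \<subseteq> {c..d})"
proof -
  define f where "f x = max 0 (max (c - x) (x - d))" for x :: real
  have "continuous_on UNIV f" unfolding f_def by (intro continuous_intros)
  from mat_fun_measurable[OF this, of n] obtain F where
    "\<forall>r<n. \<forall>c<n. (\<lambda>A. F A (r,c)) \<in> borel_measurable (borel_mat n)"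
    "\<forall>A r c. symmetric_mat n A \<longrightarrow> r < n \<longrightarrow> c < n \<longrightarrow> F A (r,c) = mat_fun f A $$ (r,c)"
    by (elim exE conjE) (rule that)
  then have F: "\<And>r c. r < n \<Longrightarrow> c < n \<Longrightarrow> (\<lambda>A. F A (r,c)) \<in> borel_measurable (borel_mat n)"
    "\<And>A r c. symmetric_mat n A \<Longrightarrow> r < n \<Longrightarrow> c < n \<Longrightarrow> F A (r,c) = mat_fun f A $$ (r,c)"
    by simp_all
  have "(\<lambda>A. \<Sum>r<n. F A (r,r)) \<in> borel_measurable (borel_mat n)"
    by (intro borel_measurable_sum F(1)) simp_all
  from measurable_sets[OF this, of "{0}"]
  have S: "{A\<in>space (borel_mat n). (\<Sum>r<n. F A (r,r)) = 0} \<in> sets (borel_mat n)"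
    by (simp add: vimage_def Int_def conj_commute)
  have "A \<in> {A\<in>space (borel_mat n). (\<Sum>r<n. F A (r,r)) = 0} \<longleftrightarrow> set (eigvals_desc A) \<subseteq> {c..d}"
    if A: "symmetric_mat n A" for A
  proof -
    note u = eigbasis_orthonormal[OF A]
    have "(\<Sum>r<n. F A (r,r)) = (\<Sum>r<n. \<Sum>i<n. f (eigvals_desc A ! i) * (eigbasis A i $ r * eigbasis A i $ r))"
      using F(2)[OF A] mat_fun_entry[OF A] by simp
    also have "\<dots> = (\<Sum>i<n. f (eigvals_desc A ! i) * (eigbasis A i \<bullet> eigbasis A i))"
      unfolding sum_distrib_left[symmetric]
      by (subst sum.swap)
         (intro sum.cong refl, simp add: sum_distrib_left scalar_prod_lessThan[OF orthonormal_basisD(2)[OF u]])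
    also have "\<dots> = (\<Sum>i<n. f (eigvals_desc A ! i))"
      using orthonormal_basisD(3)[OF u] by simp
    finally have "(\<Sum>r<n. F A (r,r)) = 0 \<longleftrightarrow> (\<forall>i<n. f (eigvals_desc A ! i) = 0)"
      by (simp add: sum_nonneg_eq_0_iff f_def Ball_def)
    also have "\<dots> \<longleftrightarrow> set (eigvals_desc A) \<subseteq> {c..d}"
    proof -
      have "f x = 0 \<longleftrightarrow> x \<in> {c..d}" for x by (auto simp: f_def max_def)
      then show ?thesis using char_poly_eigvals_desc(2)[OF A] by (auto simp: set_conv_nth)
    qed
    finally show ?thesis using symmetric_matD(1)[OF A] by simp
  qed
  then show ?thesis using S by blast
qed

text \<open>The eigenvectors in \<open>limit_form\<close> are not chosen measurably, but for a simple spectrum the form is the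
limit of normalised Frobenius distances along \<open>\<sigma> = 1 / (k + 1)\<close>.\<close>

lemma limit_form_measurable:
  assumes n: "n \<ge> 1" and h: "h C1_differentiable_on UNIV"
  shows "\<exists>X\<in>borel_measurable (borel_mat n \<Otimes>\<^sub>M borel_mat n). \<forall>A Z. symmetric_mat n A \<longrightarrow> symmetric_mat n Z \<longrightarrow>
     distinct (eigvals_desc A) \<longrightarrow> X (A,Z) = limit_form h n A Z"
proof -
  have "continuous_on UNIV h"
    using C1_derivative(1)[OF h] by (meson DERIV_isCont continuous_at_imp_continuous_on)
  from mat_fun_measurable[OF this, of n] obtain F where
    "\<forall>r<n. \<forall>c<n. (\<lambda>A. F A (r,c)) \<in> borel_measurable (borel_mat n)"
    "\<forall>A r c. symmetric_mat n A \<longrightarrow> r < n \<longrightarrow> c < n \<longrightarrow> F A (r,c) = mat_fun h A $$ (r,c)"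
    by (elim exE conjE) (rule that)
  then have F: "\<And>r c. r < n \<Longrightarrow> c < n \<Longrightarrow> (\<lambda>A. F A (r,c)) \<in> borel_measurable (borel_mat n)"
    "\<And>A r c. symmetric_mat n A \<Longrightarrow> r < n \<Longrightarrow> c < n \<Longrightarrow> F A (r,c) = mat_fun h A $$ (r,c)"
    by simp_all
  define e where "e k = inverse (real (Suc k))" for k
  define R where "R k p = (\<Sum>r<n. \<Sum>c<n. (F (perturbed n (e k) (fst p) (snd p)) (r,c) - F (fst p) (r,c))\<^sup>2)
      / (real n * (e k)\<^sup>2)" for k p
  define X where "X p = lim (\<lambda>k. R k p)" for p
  have pert: "(\<lambda>p. perturbed n s (fst p) (snd p)) \<in> measurable (borel_mat n \<Otimes>\<^sub>M borel_mat n) (borel_mat n)" for s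
  proof (rule measurable_borel_matI)
    fix i j assume ij: "i < n" "j < n"
    have "(\<lambda>p. fst p $$ (i,j) + s / sqrt n * snd p $$ (i,j)) \<in> borel_measurable (borel_mat n \<Otimes>\<^sub>M borel_mat n)"
      using measurable_compose[OF measurable_fst measurable_entry[OF ij], of "borel_mat n"]
        measurable_compose[OF measurable_snd measurable_entry[OF ij], of "borel_mat n"]
      by (intro borel_measurable_add borel_measurable_times) auto
    moreover have "(\<lambda>p. perturbed n s (fst p) (snd p) $$ (i,j)) \<in> borel_measurable (borel_mat n \<Otimes>\<^sub>M borel_mat n) \<longleftrightarrow>
       (\<lambda>p. fst p $$ (i,j) + s / sqrt n * snd p $$ (i,j)) \<in> borel_measurable (borel_mat n \<Otimes>\<^sub>M borel_mat n)"
      by (rule measurable_cong) (use ij in \<open>auto simp: space_pair_measure perturbed_def\<close>)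
    ultimately show "(\<lambda>p. perturbed n s (fst p) (snd p) $$ (i,j)) \<in> borel_measurable (borel_mat n \<Otimes>\<^sub>M borel_mat n)"
      by blast
  qed (auto simp: space_pair_measure perturbed_def)
  have Rm: "R k \<in> borel_measurable (borel_mat n \<Otimes>\<^sub>M borel_mat n)" for k
  proof -
    have "(\<lambda>p. F (perturbed n (e k) (fst p) (snd p)) (r,c)) \<in> borel_measurable (borel_mat n \<Otimes>\<^sub>M borel_mat n)"
      "(\<lambda>p. F (fst p) (r,c)) \<in> borel_measurable (borel_mat n \<Otimes>\<^sub>M borel_mat n)" if "r < n" "c < n" for r c
      using measurable_compose[OF pert F(1)[OF that]] measurable_compose[OF measurable_fst F(1)[OF that]] by blast+
    then show ?thesis unfolding R_def
      by (intro borel_measurable_divide borel_measurable_sum borel_measurable_power borel_measurable_diff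
          borel_measurable_const) auto
  qed
  have "X (A,Z) = limit_form h n A Z" if A: "symmetric_mat n A" and Z: "symmetric_mat n Z" and d: "distinct (eigvals_desc A)" for A Z
  proof -
    have "(\<lambda>k. (frobenius_norm (mat_fun h (perturbed n (e k) A Z) - mat_fun h A))\<^sup>2 / (real n * (e k)\<^sup>2)) \<longlonglongrightarrow> limit_form h n A Z"
    proof (rule filterlim_compose[OF frobenius_perturbed_tendsto[OF n A Z d isCont_divdiff[OF h]]])
      show "filterlim e (at_right 0) sequentially"
        unfolding filterlim_at e_def using LIMSEQ_inverse_real_of_nat by auto
    qed
    moreover have "R k (A,Z) = (frobenius_norm (mat_fun h (perturbed n (e k) A Z) - mat_fun h A))\<^sup>2 / (real n * (e k)\<^sup>2)" for k
    proof -
      note P = perturbed_symmetric_mat[OF A Z, of "e k"]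
      have "(frobenius_norm (mat_fun h (perturbed n (e k) A Z) - mat_fun h A))\<^sup>2 =
         (\<Sum>r<n. \<Sum>c<n. (mat_fun h (perturbed n (e k) A Z) $$ (r,c) - mat_fun h A $$ (r,c))\<^sup>2)"
        using mat_fun_carrier[OF A, of h] mat_fun_carrier[OF P, of h]
        by (simp add: frobenius_norm_def sum_nonneg)
      then show ?thesis unfolding R_def using F(2)[OF A] F(2)[OF P] by simp
    qed
    ultimately show ?thesis unfolding X_def by (intro limI) simp
  qed
  moreover have "X \<in> borel_measurable (borel_mat n \<Otimes>\<^sub>M borel_mat n)"
    unfolding X_def by (intro borel_measurable_lim_metric Rm)
  ultimately show ?thesis by blast
qed

section \<open>Almost sure convergence\<close>

definition limit_mean :: "(real \<Rightarrow> real) \<Rightarrow> nat \<Rightarrow> real mat \<Rightarrow> real" where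
  "limit_mean h n A =
     ((\<Sum>i<n. \<Sum>j<n. (divdiff h (eigvals_desc A ! i) (eigvals_desc A ! j))\<^sup>2) +
      (\<Sum>i<n. (divdiff h (eigvals_desc A ! i) (eigvals_desc A ! i))\<^sup>2)) / (real n)\<^sup>2"

text \<open>Here \<open>A\<close> is deterministic: these are the conditional mean and variance given the first matrix.\<close>

lemma (in prob_space) limit_form_variance:
  assumes n: "n \<ge> 1" and A: "symmetric_mat n A" and goe: "GOE n Z"
    and B: "\<And>s t. s \<in> {c..d} \<Longrightarrow> t \<in> {c..d} \<Longrightarrow> (divdiff h s t)\<^sup>2 \<le> B"
    and spec: "set (eigvals_desc A) \<subseteq> {c..d}"
  shows "expectation (\<lambda>\<omega>. limit_form h n A (Z \<omega>)) = limit_mean h n A"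
    and "(\<integral>\<^sup>+\<omega>. ennreal ((limit_form h n A (Z \<omega>) - limit_mean h n A)\<^sup>2) \<partial>M) \<le> ennreal (8 * B\<^sup>2 / (real n)\<^sup>2)"
proof -
  define G where "G i j = (divdiff h (eigvals_desc A ! i) (eigvals_desc A ! j))\<^sup>2" for i j
  have "eigvals_desc A ! i \<in> {c..d}" if "i < n" for i
    using spec char_poly_eigvals_desc(2)[OF A] that nth_mem by blast
  then have GB: "\<bar>G i j\<bar> \<le> B" if "i < n" "j < n" for i j using B that by (simp add: G_def)
  define Q where "Q \<omega> = (\<Sum>i<n. \<Sum>j<n. G i j * (eigbasis A i \<bullet> (Z \<omega> *\<^sub>v eigbasis A j))\<^sup>2)" for \<omega>
  define m where "m = (\<Sum>i<n. \<Sum>j<n. G i j) + (\<Sum>i<n. G i i)"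
  note var = GOE_quadratic_variance[where G=G and K=B, OF goe eigbasis_orthonormal[OF A] GB, folded Q_def m_def]
  have lf: "limit_form h n A (Z \<omega>) = Q \<omega> / (real n)\<^sup>2" for \<omega>
    by (simp add: limit_form_def Q_def G_def)
  have lm: "limit_mean h n A = m / (real n)\<^sup>2" by (simp add: limit_mean_def m_def G_def)
  show "expectation (\<lambda>\<omega>. limit_form h n A (Z \<omega>)) = limit_mean h n A"
    using has_bochner_integral_integral_eq[OF var(1)] by (simp add: lf lm)
  have sq: "(limit_form h n A (Z \<omega>) - limit_mean h n A)\<^sup>2 = (Q \<omega> - m)\<^sup>2 / (real n) ^ 4" for \<omega>
    by (simp add: lf lm diff_divide_distrib[symmetric] power_divide)
  have "(\<integral>\<^sup>+\<omega>. ennreal ((limit_form h n A (Z \<omega>) - limit_mean h n A)\<^sup>2) \<partial>M)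
      = ennreal (expectation (\<lambda>\<omega>. (Q \<omega> - m)\<^sup>2 / (real n) ^ 4))"
    unfolding sq using var(2) by (intro nn_integral_eq_integral) auto
  also have "\<dots> \<le> ennreal (8 * B\<^sup>2 / (real n)\<^sup>2)"
  proof (rule ennreal_leI)
    have "expectation (\<lambda>\<omega>. (Q \<omega> - m)\<^sup>2 / (real n) ^ 4) \<le> 8 * B\<^sup>2 * (real n)\<^sup>2 / (real n) ^ 4"
      using var(3) by (simp add: divide_right_mono)
    also have "\<dots> = 8 * B\<^sup>2 / (real n)\<^sup>2" using n by (simp add: power4_eq_xxxx power2_eq_square)
    finally show "expectation (\<lambda>\<omega>. (Q \<omega> - m)\<^sup>2 / (real n) ^ 4) \<le> 8 * B\<^sup>2 / (real n)\<^sup>2" .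
  qed
  finally show "(\<integral>\<^sup>+\<omega>. ennreal ((limit_form h n A (Z \<omega>) - limit_mean h n A)\<^sup>2) \<partial>M) \<le> ennreal (8 * B\<^sup>2 / (real n)\<^sup>2)" .
qed

text \<open>By independence the law of \<open>(A, Z)\<close> is a product, so Fubini's theorem reduces the mean square to the
case of a deterministic \<open>A\<close>. The squared deviation need not be measurable itself; \<open>V\<close> is a measurable
function that agrees with it almost everywhere on the event that the spectrum lies in the interval
and is cut off to 0 outside, where the divided differences are not controlled.\<close>

lemma (in prob_space) limit_form_deviation:
  assumes n: "n \<ge> 1" and h: "h C1_differentiable_on UNIV"
    and A: "\<And>\<omega>. \<omega> \<in> space M \<Longrightarrow> symmetric_mat n (A \<omega>)"
    and simple: "AE \<omega> in M. distinct (eigvals_desc (A \<omega>))"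
    and indep: "indep_var (borel_mat n) A (borel_mat n) Z" and goe: "GOE n Z"
    and B: "\<And>s t. s \<in> {c..d} \<Longrightarrow> t \<in> {c..d} \<Longrightarrow> (divdiff h s t)\<^sup>2 \<le> B"
  shows "\<exists>V. V \<in> borel_measurable M \<and> (\<forall>\<omega>. 0 \<le> V \<omega>) \<and>
     (\<integral>\<^sup>+\<omega>. ennreal (V \<omega>) \<partial>M) \<le> ennreal (8 * B\<^sup>2 / (real n)\<^sup>2) \<and>
     (AE \<omega> in M. set (eigvals_desc (A \<omega>)) \<subseteq> {c..d} \<longrightarrow>
        V \<omega> = (limit_form h n (A \<omega>) (Z \<omega>) - limit_mean h n (A \<omega>))\<^sup>2)"
proof -
  let ?N = "borel_mat n"
  have Z: "symmetric_mat n (Z \<omega>)" if "\<omega> \<in> space M" for \<omega> using goe that by (auto simp: GOE_def)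
  obtain X where X [measurable]: "X \<in> borel_measurable (?N \<Otimes>\<^sub>M ?N)"
    and Xeq: "\<And>A Z. symmetric_mat n A \<Longrightarrow> symmetric_mat n Z \<Longrightarrow> distinct (eigvals_desc A) \<Longrightarrow> X (A,Z) = limit_form h n A Z"
    using limit_form_measurable[OF n h] by metis
  obtain S where S [measurable]: "S \<in> sets ?N"
    and Seq: "\<And>A. symmetric_mat n A \<Longrightarrow> (A \<in> S \<longleftrightarrow> set (eigvals_desc A) \<subseteq> {c..d})"
    using spectrum_in_interval_measurable[of n c d] by metis
  have rv [measurable]: "A \<in> measurable M ?N" "Z \<in> measurable M ?N"
    and joint: "distr M ?N A \<Otimes>\<^sub>M distr M ?N Z = distr M (?N \<Otimes>\<^sub>M ?N) (\<lambda>\<omega>. (A \<omega>, Z \<omega>))"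
    using indep_var_distribution_eq[of ?N A ?N Z] indep by auto
  interpret LZ: prob_space "distr M ?N Z" by (rule prob_space_distr) measurable
  define m where "m a = (\<integral>z. X (a,z) \<partial>distr M ?N Z)" for a
  have m [measurable]: "m \<in> borel_measurable ?N"
    unfolding m_def by (rule LZ.borel_measurable_lebesgue_integral) simp
  define D where "D p = indicat_real S (fst p) * (X p - m (fst p))\<^sup>2" for p
  have D [measurable]: "D \<in> borel_measurable (?N \<Otimes>\<^sub>M ?N)"
    unfolding D_def by measurable
  define V where "V \<omega> = D (A \<omega>, Z \<omega>)" for \<omega>
  have m_eq: "m (A \<omega>) = limit_mean h n (A \<omega>)"
    if \<omega>: "\<omega> \<in> space M" "distinct (eigvals_desc (A \<omega>))" "set (eigvals_desc (A \<omega>)) \<subseteq> {c..d}" for \<omega>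
  proof -
    have [measurable]: "(\<lambda>z. X (A \<omega>, z)) \<in> borel_measurable ?N"
      using measurable_space[OF rv(1) \<omega>(1)] by measurable
    have "m (A \<omega>) = expectation (\<lambda>\<omega>'. X (A \<omega>, Z \<omega>'))"
      unfolding m_def by (rule integral_distr) measurable
    also have "\<dots> = expectation (\<lambda>\<omega>'. limit_form h n (A \<omega>) (Z \<omega>'))"
      by (rule Bochner_Integration.integral_cong) (use Xeq[OF A Z] \<omega> in auto)
    also have "\<dots> = limit_mean h n (A \<omega>)"
      by (rule limit_form_variance(1)[OF n A[OF \<omega>(1)] goe B \<omega>(3)])
    finally show ?thesis .
  qed
  have Vm: "V \<in> borel_measurable M" unfolding V_def by measurable
  have V0: "0 \<le> V \<omega>" for \<omega> by (simp add: V_def D_def)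
  have "(\<integral>\<^sup>+\<omega>. ennreal (V \<omega>) \<partial>M) = (\<integral>\<^sup>+p. ennreal (D p) \<partial>distr M (?N \<Otimes>\<^sub>M ?N) (\<lambda>\<omega>. (A \<omega>, Z \<omega>)))"
    unfolding V_def by (rule nn_integral_distr[symmetric]) measurable
  also have "\<dots> = (\<integral>\<^sup>+a. \<integral>\<^sup>+z. ennreal (D (a,z)) \<partial>distr M ?N Z \<partial>distr M ?N A)"
    unfolding joint[symmetric] by (rule LZ.nn_integral_fst[symmetric]) simp
  also have "\<dots> = (\<integral>\<^sup>+\<omega>. \<integral>\<^sup>+z. ennreal (D (A \<omega>,z)) \<partial>distr M ?N Z \<partial>M)"
    by (rule nn_integral_distr[OF rv(1)]) simp
  also have "\<dots> = (\<integral>\<^sup>+\<omega>. \<integral>\<^sup>+\<omega>'. ennreal (D (A \<omega>, Z \<omega>')) \<partial>M \<partial>M)"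
  proof (rule nn_integral_cong)
    fix \<omega> assume "\<omega> \<in> space M"
    then have [measurable]: "A \<omega> \<in> space ?N" using measurable_space[OF rv(1)] by blast
    show "(\<integral>\<^sup>+z. ennreal (D (A \<omega>,z)) \<partial>distr M ?N Z) = (\<integral>\<^sup>+\<omega>'. ennreal (D (A \<omega>, Z \<omega>')) \<partial>M)"
      by (rule nn_integral_distr) measurable
  qed
  also have "\<dots> \<le> (\<integral>\<^sup>+\<omega>. ennreal (8 * B\<^sup>2 / (real n)\<^sup>2) \<partial>M)"
  proof (rule nn_integral_mono_AE)
    show "AE \<omega> in M. (\<integral>\<^sup>+\<omega>'. ennreal (D (A \<omega>, Z \<omega>')) \<partial>M) \<le> ennreal (8 * B\<^sup>2 / (real n)\<^sup>2)"
      using simple AE_space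
    proof eventually_elim
      case (elim \<omega>)
      show ?case
      proof (cases "A \<omega> \<in> S")
        case True
        then have spec: "set (eigvals_desc (A \<omega>)) \<subseteq> {c..d}" using Seq[OF A[OF elim(2)]] by blast
        have "(\<integral>\<^sup>+\<omega>'. ennreal (D (A \<omega>, Z \<omega>')) \<partial>M)
           = (\<integral>\<^sup>+\<omega>'. ennreal ((limit_form h n (A \<omega>) (Z \<omega>') - limit_mean h n (A \<omega>))\<^sup>2) \<partial>M)"
          by (rule nn_integral_cong)
             (use True Xeq[OF A Z] elim m_eq[OF elim(2,1) spec] in \<open>simp add: D_def\<close>)
        also have "\<dots> \<le> ennreal (8 * B\<^sup>2 / (real n)\<^sup>2)"
          by (rule limit_form_variance(2)[OF n A[OF elim(2)] goe B spec])
        finally show ?thesis .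
      qed (simp add: D_def)
    qed
  qed
  also have "\<dots> = ennreal (8 * B\<^sup>2 / (real n)\<^sup>2)" by (simp add: emeasure_space_1)
  finally have int: "(\<integral>\<^sup>+\<omega>. ennreal (V \<omega>) \<partial>M) \<le> ennreal (8 * B\<^sup>2 / (real n)\<^sup>2)" .
  have "AE \<omega> in M. set (eigvals_desc (A \<omega>)) \<subseteq> {c..d} \<longrightarrow>
        V \<omega> = (limit_form h n (A \<omega>) (Z \<omega>) - limit_mean h n (A \<omega>))\<^sup>2"
    using simple AE_space
  proof eventually_elim
    case (elim \<omega>)
    then show ?case using Seq[OF A] Xeq[OF A Z] m_eq by (simp add: V_def D_def)
  qed
  then show ?thesis using Vm V0 int by blast
qed

text \<open>A series of nonnegative functions whose integrals are summable converges almost everywhere, so its terms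
tend to 0.\<close>

lemma (in prob_space) AE_tendsto_0_if_summable:
  assumes V: "\<And>n. V n \<in> borel_measurable M" "\<And>n \<omega>. 0 \<le> V n \<omega>"
    and int: "\<And>n. (\<integral>\<^sup>+\<omega>. ennreal (V n \<omega>) \<partial>M) \<le> ennreal (a n)"
    and a: "\<And>n. 0 \<le> a n" "summable a"
  shows "AE \<omega> in M. (\<lambda>n. V n \<omega>) \<longlonglongrightarrow> (0::real)"
proof -
  note [measurable] = V(1)
  have "(\<integral>\<^sup>+\<omega>. (\<Sum>n. ennreal (V n \<omega>)) \<partial>M) = (\<Sum>n. \<integral>\<^sup>+\<omega>. ennreal (V n \<omega>) \<partial>M)"
    by (rule nn_integral_suminf) measurable
  also have "\<dots> \<le> (\<Sum>n. ennreal (a n))" by (intro suminf_le int summableI)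
  also have "\<dots> = ennreal (suminf a)" by (rule suminf_ennreal2[OF a])
  also have "\<dots> < \<infinity>" by simp
  finally have "(\<integral>\<^sup>+\<omega>. (\<Sum>n. ennreal (V n \<omega>)) \<partial>M) \<noteq> \<infinity>" by simp
  then have "AE \<omega> in M. (\<Sum>n. ennreal (V n \<omega>)) \<noteq> \<infinity>"
    by (intro nn_integral_PInf_AE) measurable
  then show ?thesis
  proof eventually_elim
    case (elim \<omega>)
    then have "summable (\<lambda>n. V n \<omega>)" using V(2) by (intro summable_suminf_not_top) auto
    then show ?case by (rule summable_LIMSEQ_zero)
  qed
qed

text \<open>Once the spectrum lies in the interval, and up to the diagonal sum, which is \<open>O(1/n)\<close>, the mean is the double integral of the clamped kernel
against the spectral distribution. Indices are shifted by one because the spectral distribution of a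
matrix of size 0 is not a probability measure.\<close>

lemma limit_mean_tendsto:
  assumes h: "h C1_differentiable_on UNIV"
    and a: "\<And>n. n \<ge> 1 \<Longrightarrow> symmetric_mat n (a n)"
    and conv: "weak_conv_m (\<lambda>n. esd n (a n)) H" and H: "real_distribution H"
    and cd: "c \<le> d" and HS: "AE x in H. x \<in> {c..d}"
    and spec: "\<forall>\<^sub>F n in sequentially. set (eigvals_desc (a n)) \<subseteq> {c..d}"
  shows "(\<lambda>n. limit_mean h n (a n)) \<longlonglongrightarrow>
     (\<integral>s. (\<integral>t. (if s = t then (deriv h t)\<^sup>2 else (h t - h s)\<^sup>2 / (t - s)\<^sup>2) \<partial>H) \<partial>H)"
proof -
  define G where "G p = (divdiff h (clamp_to c d (fst p)) (clamp_to c d (snd p)))\<^sup>2" for p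
  have Gc: "continuous_on UNIV G" and "\<exists>B. \<forall>p. \<bar>G p\<bar> \<le> B"
    using divdiff_clamped[OF h cd, folded G_def] by blast+
  then obtain B where B: "\<And>p. \<bar>G p\<bar> \<le> B" by blast
  have Gid: "G (s,t) = (divdiff h s t)\<^sup>2" if "s \<in> {c..d}" "t \<in> {c..d}" for s t
    using that by (simp add: G_def clamp_to_id)
  define \<mu> where "\<mu> n = esd (Suc n) (a (Suc n))" for n
  have mu: "real_distribution (\<mu> n)" for n unfolding \<mu>_def by (rule esd_real_distribution) simp
  have "weak_conv_m \<mu> H"
    using conv unfolding weak_conv_m_def weak_conv_def \<mu>_def by (auto intro: LIMSEQ_Suc)
  from weak_conv_double_integral[OF mu H this Gc B]
  have lim: "(\<lambda>n. \<integral>s. (\<integral>t. G (s,t) \<partial>\<mu> n) \<partial>\<mu> n) \<longlonglongrightarrow> (\<integral>s. (\<integral>t. G (s,t) \<partial>H) \<partial>H)" .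
  have Gm: "G \<in> borel_measurable (borel \<Otimes>\<^sub>M borel)"
    using borel_measurable_continuous_onI[OF Gc] by (simp add: borel_prod)
  note [measurable] = Gm
  have dbl: "(\<integral>s. (\<integral>t. G (s,t) \<partial>\<mu> n) \<partial>\<mu> n) =
      (\<Sum>i<Suc n. \<Sum>j<Suc n. G (eigvals_desc (a (Suc n)) ! i, eigvals_desc (a (Suc n)) ! j)) / (real (Suc n))\<^sup>2" for n
  proof -
    have "(\<integral>t. G (s,t) \<partial>\<mu> n) = (\<Sum>j<Suc n. G (s, eigvals_desc (a (Suc n)) ! j)) / real (Suc n)" for s
      unfolding \<mu>_def by (rule integral_esd) simp_all
    then have "(\<integral>s. (\<integral>t. G (s,t) \<partial>\<mu> n) \<partial>\<mu> n) = (\<integral>s. (\<Sum>j<Suc n. G (s, eigvals_desc (a (Suc n)) ! j)) / real (Suc n) \<partial>\<mu> n)"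
      by simp
    also have "\<dots> = (\<Sum>i<Suc n. (\<Sum>j<Suc n. G (eigvals_desc (a (Suc n)) ! i, eigvals_desc (a (Suc n)) ! j)) / real (Suc n)) / real (Suc n)"
      unfolding \<mu>_def by (rule integral_esd) (simp_all del: sum.lessThan_Suc)
    finally show ?thesis by (simp only: sum_divide_distrib[symmetric] power2_eq_square divide_divide_eq_left)
  qed
  define diag where "diag n = (\<Sum>i<Suc n. G (eigvals_desc (a (Suc n)) ! i, eigvals_desc (a (Suc n)) ! i)) / (real (Suc n))\<^sup>2" for n
  have "diag \<longlonglongrightarrow> 0"
  proof (rule Lim_null_comparison)
    have "norm (diag n) \<le> B * inverse (real (Suc n))" for n
    proof -
      have "\<bar>\<Sum>i<Suc n. G (eigvals_desc (a (Suc n)) ! i, eigvals_desc (a (Suc n)) ! i)\<bar> \<le> (\<Sum>i<Suc n. B)"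
        by (rule order_trans[OF sum_abs]) (intro sum_mono B)
      then have "norm (diag n) \<le> (\<Sum>i<Suc n. B) / (real (Suc n))\<^sup>2"
        unfolding diag_def real_norm_def abs_divide by (simp only: abs_power2 divide_right_mono zero_le_power2)
      also have "\<dots> = B * inverse (real (Suc n))"
        by (simp add: power2_eq_square inverse_eq_divide del: of_nat_Suc)
      finally show ?thesis .
    qed
    then show "\<forall>\<^sub>F n in sequentially. norm (diag n) \<le> B * inverse (real (Suc n))" by simp
    show "(\<lambda>n. B * inverse (real (Suc n))) \<longlonglongrightarrow> 0"
      by (intro tendsto_mult_right_zero LIMSEQ_inverse_real_of_nat)
  qed
  from tendsto_add[OF lim this]
  have "(\<lambda>n. (\<integral>s. (\<integral>t. G (s,t) \<partial>\<mu> n) \<partial>\<mu> n) + diag n) \<longlonglongrightarrow> (\<integral>s. (\<integral>t. G (s,t) \<partial>H) \<partial>H)" by simp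
  moreover have "\<forall>\<^sub>F n in sequentially. (\<integral>s. (\<integral>t. G (s,t) \<partial>\<mu> n) \<partial>\<mu> n) + diag n = limit_mean h (Suc n) (a (Suc n))"
    using eventually_sequentially_Suc[THEN iffD2, OF spec]
  proof eventually_elim
    case (elim n)
    have mem: "eigvals_desc (a (Suc n)) ! i \<in> {c..d}" if "i < Suc n" for i
      using elim char_poly_eigvals_desc(2)[OF a[of "Suc n"]] that nth_mem by force
    have "G (eigvals_desc (a (Suc n)) ! i, eigvals_desc (a (Suc n)) ! j) = (divdiff h (eigvals_desc (a (Suc n)) ! i) (eigvals_desc (a (Suc n)) ! j))\<^sup>2"
      if "i < Suc n" "j < Suc n" for i j using Gid[OF mem mem] that by blast
    then show ?case
      unfolding dbl diag_def limit_mean_def add_divide_distrib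
      by (intro arg_cong2[where f="(+)"] arg_cong2[where f="(/)"] sum.cong refl) auto
  qed
  ultimately have "(\<lambda>n. limit_mean h (Suc n) (a (Suc n))) \<longlonglongrightarrow> (\<integral>s. (\<integral>t. G (s,t) \<partial>H) \<partial>H)"
    by (rule Lim_transform_eventually)
  then have "(\<lambda>n. limit_mean h n (a n)) \<longlonglongrightarrow> (\<integral>s. (\<integral>t. G (s,t) \<partial>H) \<partial>H)" by (rule LIMSEQ_imp_Suc)
  moreover have "(\<integral>s. (\<integral>t. G (s,t) \<partial>H) \<partial>H) = (\<integral>s. (\<integral>t. (divdiff h s t)\<^sup>2 \<partial>H) \<partial>H)"
  proof -
    interpret H: real_distribution H by (rule H)
    have "continuous_on UNIV (\<lambda>(s,t). divdiff h s t)"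
      using isCont_divdiff_joint[OF h] by (simp add: continuous_at_imp_continuous_on)
    from borel_measurable_continuous_onI[OF this]
    have dm [measurable]: "(\<lambda>(s,t). divdiff h s t) \<in> borel_measurable (borel \<Otimes>\<^sub>M borel)"
      by (simp add: borel_prod)
    have inner: "(\<integral>t. G (s,t) \<partial>H) = (\<integral>t. (divdiff h s t)\<^sup>2 \<partial>H)" if "s \<in> {c..d}" for s
    proof (rule integral_cong_AE)
      show "AE t in H. G (s,t) = (divdiff h s t)\<^sup>2" using HS by eventually_elim (rule Gid[OF that])
    qed measurable
    have "AE s in H. (\<integral>t. G (s,t) \<partial>H) = (\<integral>t. (divdiff h s t)\<^sup>2 \<partial>H)"
      using HS by eventually_elim (rule inner)
    then show ?thesis by (intro integral_cong_AE) measurable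
  qed
  moreover have "(divdiff h s t)\<^sup>2 = (if s = t then (deriv h t)\<^sup>2 else (h t - h s)\<^sup>2 / (t - s)\<^sup>2)" for s t
    by (simp add: divdiff_def power_divide)
  ultimately show ?thesis by simp
qed

theorem proposition5p2:
  fixes M :: "'a measure"
    and A Z :: "nat \<Rightarrow> 'a \<Rightarrow> real mat"
    and H :: "real measure"
    and h1 h2 :: real
    and h :: "real \<Rightarrow> real"
  assumes "prob_space M"
    and symmetric: "\<And>n \<omega>. n \<ge> 1 \<Longrightarrow> \<omega> \<in> space M \<Longrightarrow> symmetric_mat n (A n \<omega>)"
    and simple_spectrum: "\<And>n. n \<ge> 1 \<Longrightarrow> AE \<omega> in M. distinct (eigvals_desc (A n \<omega>))"
    and "real_distribution H"
    and esd_limit: "AE \<omega> in M. weak_conv_m (\<lambda>n. esd n (A n \<omega>)) H"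
    and compact_support: "\<exists>a b. measure H {a..b} = 1"
    and bounded_spectrum:
      "AE \<omega> in M. \<forall>\<^sub>F n in sequentially. set (eigvals_desc (A n \<omega>)) \<subseteq> {h1..h2}"
    and indep: "\<And>n. n \<ge> 1 \<Longrightarrow>
      prob_space.indep_var M (borel_mat n) (A n) (borel_mat n) (Z n)"
    and GOE: "\<And>n. n \<ge> 1 \<Longrightarrow> prob_space.GOE M n (Z n)"
    and C1: "h C1_differentiable_on UNIV"
  shows
    "(\<forall>n\<ge>1. \<forall>\<omega>\<in>space M. distinct (eigvals_desc (A n \<omega>)) \<longrightarrow>
        (\<forall>w :: real \<Rightarrow> nat \<Rightarrow> real vec.
          (\<forall>\<sigma>>0. orthonormal_eigenbasis (perturbed n \<sigma> (A n \<omega>) (Z n \<omega>)) (w \<sigma>)) \<longrightarrow>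
          ((\<lambda>\<sigma>. MAX i\<in>{..<n}.
              \<bar>w \<sigma> i \<bullet> (mat_fun h (A n \<omega>) *\<^sub>v w \<sigma> i) - h (eigvals_desc (A n \<omega>) ! i)\<bar> / \<sigma>)
            \<longlongrightarrow> 0) (at_right 0)))
     \<and>
     (AE \<omega> in M. \<exists>L :: nat \<Rightarrow> real.
        (\<forall>n\<ge>1.
          ((\<lambda>\<sigma>. (frobenius_norm
                (mat_fun h (perturbed n \<sigma> (A n \<omega>) (Z n \<omega>)) - mat_fun h (A n \<omega>)))\<^sup>2
              / (real n * \<sigma>\<^sup>2)) \<longlongrightarrow> L n) (at_right 0)) \<and>
        L \<longlonglongrightarrow>
          (\<integral>s. (\<integral>t. (if s = t then (deriv h t)\<^sup>2 else (h t - h s)\<^sup>2 / (t - s)\<^sup>2) \<partial>H) \<partial>H))"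
proof -
  interpret prob_space M by (rule assms(1))
  interpret H: real_distribution H by (rule assms(4))
  have Zsym: "symmetric_mat n (Z n \<omega>)" if "n \<ge> 1" "\<omega> \<in> space M" for n \<omega>
    using GOE[OF that(1)] that(2) by (auto simp: GOE_def)
  have part1: "((\<lambda>\<sigma>. MAX i\<in>{..<n}.
        \<bar>w \<sigma> i \<bullet> (mat_fun h (A n \<omega>) *\<^sub>v w \<sigma> i) - h (eigvals_desc (A n \<omega>) ! i)\<bar> / \<sigma>) \<longlongrightarrow> 0) (at_right 0)"
    if "n \<ge> 1" "\<omega> \<in> space M" "distinct (eigvals_desc (A n \<omega>))"
      "\<forall>\<sigma>>0. orthonormal_eigenbasis (perturbed n \<sigma> (A n \<omega>) (Z n \<omega>)) (w \<sigma>)" for n \<omega> and w :: "real \<Rightarrow> nat \<Rightarrow> real vec"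
  proof -
    interpret small_perturbation n "A n \<omega>" "Z n \<omega>" w
      by unfold_locales (use that symmetric Zsym in auto)
    show ?thesis by (rule oracle_tendsto)
  qed
  obtain a b where ab: "measure H {a..b} = 1" using compact_support by blast
  have "a \<le> b"
  proof (rule ccontr)
    assume "\<not> a \<le> b"
    then have "{a..b} = {}" by simp
    then show False using ab by simp
  qed
  \<comment> \<open>The interval has to carry both the limit law and the spectra.\<close>
  define c d where "c = min a h1" and "d = max b h2"
  have cd: "c \<le> d" using \<open>a \<le> b\<close> by (simp add: c_def d_def)
  have "AE x in H. x \<in> {a..b}" using ab by (rule H.AE_prob_1)
  then have HS: "AE x in H. x \<in> {c..d}"
    by eventually_elim (auto simp: c_def d_def)
  obtain B where "\<forall>p. \<bar>(divdiff h (clamp_to c d (fst p)) (clamp_to c d (snd p)))\<^sup>2\<bar> \<le> B"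
    using divdiff_clamped(2)[OF C1 cd] by blast
  then have B: "(divdiff h s t)\<^sup>2 \<le> B" if "s \<in> {c..d}" "t \<in> {c..d}" for s t
    using that by (metis abs_power2 clamp_to_id fst_conv snd_conv)
  \<comment> \<open>Sizes start at 1, so the \<open>n\<close>-th function concerns matrices of size \<open>n + 1\<close>.\<close>
  define majorant where "majorant n V \<longleftrightarrow> V \<in> borel_measurable M \<and> (\<forall>\<omega>. 0 \<le> V \<omega>) \<and>
     (\<integral>\<^sup>+\<omega>. ennreal (V \<omega>) \<partial>M) \<le> ennreal (8 * B\<^sup>2 / (real (Suc n))\<^sup>2) \<and>
     (AE \<omega> in M. set (eigvals_desc (A (Suc n) \<omega>)) \<subseteq> {c..d} \<longrightarrow>
        V \<omega> = (limit_form h (Suc n) (A (Suc n) \<omega>) (Z (Suc n) \<omega>) - limit_mean h (Suc n) (A (Suc n) \<omega>))\<^sup>2)"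
    for n and V :: "'a \<Rightarrow> real"
  have "\<exists>V. majorant n V" for n
    unfolding majorant_def
    by (rule limit_form_deviation[OF _ C1 symmetric simple_spectrum indep GOE B]) simp_all
  then obtain V where "\<And>n. majorant n (V n)" by metis
  then have V: "\<And>n. V n \<in> borel_measurable M" "\<And>n \<omega>. 0 \<le> V n \<omega>"
     "\<And>n. (\<integral>\<^sup>+\<omega>. ennreal (V n \<omega>) \<partial>M) \<le> ennreal (8 * B\<^sup>2 / (real (Suc n))\<^sup>2)"
     and Veq: "\<And>n. AE \<omega> in M. set (eigvals_desc (A (Suc n) \<omega>)) \<subseteq> {c..d} \<longrightarrow>
        V n \<omega> = (limit_form h (Suc n) (A (Suc n) \<omega>) (Z (Suc n) \<omega>) - limit_mean h (Suc n) (A (Suc n) \<omega>))\<^sup>2"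
    unfolding majorant_def by blast+
  have "summable (\<lambda>n. 8 * B\<^sup>2 * inverse ((real (Suc n))\<^sup>2))"
    using inverse_power_summable[of 2, where 'a=real] summable_Suc_iff[of "\<lambda>n. inverse ((real n)\<^sup>2)"]
    by (intro summable_mult) (simp del: of_nat_Suc)
  then have V0: "AE \<omega> in M. (\<lambda>n. V n \<omega>) \<longlonglongrightarrow> 0"
    by (intro AE_tendsto_0_if_summable[OF V]) (simp_all add: divide_inverse)
  have Veq': "AE \<omega> in M. \<forall>n. set (eigvals_desc (A (Suc n) \<omega>)) \<subseteq> {c..d} \<longrightarrow>
        V n \<omega> = (limit_form h (Suc n) (A (Suc n) \<omega>) (Z (Suc n) \<omega>) - limit_mean h (Suc n) (A (Suc n) \<omega>))\<^sup>2"
    using Veq by (simp add: AE_all_countable)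
  have "AE \<omega> in M. \<forall>n. distinct (eigvals_desc (A (Suc n) \<omega>))"
    using simple_spectrum by (simp add: AE_all_countable)
  then have "AE \<omega> in M. \<exists>L :: nat \<Rightarrow> real.
        (\<forall>n\<ge>1.
          ((\<lambda>\<sigma>. (frobenius_norm
                (mat_fun h (perturbed n \<sigma> (A n \<omega>) (Z n \<omega>)) - mat_fun h (A n \<omega>)))\<^sup>2
              / (real n * \<sigma>\<^sup>2)) \<longlongrightarrow> L n) (at_right 0)) \<and>
        L \<longlonglongrightarrow>
          (\<integral>s. (\<integral>t. (if s = t then (deriv h t)\<^sup>2 else (h t - h s)\<^sup>2 / (t - s)\<^sup>2) \<partial>H) \<partial>H)"
    using V0 Veq' esd_limit bounded_spectrum AE_space
  proof eventually_elim
    case (elim \<omega>)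
    let ?I = "\<integral>s. (\<integral>t. (if s = t then (deriv h t)\<^sup>2 else (h t - h s)\<^sup>2 / (t - s)\<^sup>2) \<partial>H) \<partial>H"
    define L where "L n = limit_form h n (A n \<omega>) (Z n \<omega>)" for n
    have "((\<lambda>\<sigma>. (frobenius_norm (mat_fun h (perturbed n \<sigma> (A n \<omega>) (Z n \<omega>)) - mat_fun h (A n \<omega>)))\<^sup>2
              / (real n * \<sigma>\<^sup>2)) \<longlongrightarrow> L n) (at_right 0)" if n: "n \<ge> 1" for n
    proof -
      have "distinct (eigvals_desc (A n \<omega>))" using elim(1) n by (cases n) auto
      then show ?thesis unfolding L_def
        by (intro frobenius_perturbed_tendsto n symmetric Zsym elim(6) isCont_divdiff C1)
    qed
    moreover have "L \<longlonglongrightarrow> ?I"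
    proof -
      have spec: "\<forall>\<^sub>F n in sequentially. set (eigvals_desc (A n \<omega>)) \<subseteq> {c..d}"
      proof -
        have "{h1..h2} \<subseteq> {c..d}" by (auto simp: c_def d_def)
        with elim(5) show ?thesis by (auto elim!: eventually_mono)
      qed
      have "(\<lambda>n. limit_mean h n (A n \<omega>)) \<longlonglongrightarrow> ?I"
        by (rule limit_mean_tendsto[OF C1 _ elim(4) assms(4) cd HS spec]) (use symmetric elim(6) in blast)
      then have mean: "(\<lambda>n. limit_mean h (Suc n) (A (Suc n) \<omega>)) \<longlonglongrightarrow> ?I" by (rule LIMSEQ_Suc)
      have "(\<lambda>n. \<bar>L (Suc n) - limit_mean h (Suc n) (A (Suc n) \<omega>)\<bar>) \<longlonglongrightarrow> 0"
      proof (rule Lim_transform_eventually)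
        show "(\<lambda>n. sqrt (V n \<omega>)) \<longlonglongrightarrow> 0" using tendsto_real_sqrt[OF elim(2)] by simp
        show "\<forall>\<^sub>F n in sequentially. sqrt (V n \<omega>) = \<bar>L (Suc n) - limit_mean h (Suc n) (A (Suc n) \<omega>)\<bar>"
          using eventually_sequentially_Suc[THEN iffD2, OF spec]
          by eventually_elim (use elim(3) in \<open>simp add: L_def\<close>)
      qed
      then have "(\<lambda>n. L (Suc n) - limit_mean h (Suc n) (A (Suc n) \<omega>)) \<longlonglongrightarrow> 0"
        by (simp only: tendsto_rabs_zero_iff)
      from tendsto_add[OF this mean] have "(\<lambda>n. L (Suc n)) \<longlonglongrightarrow> ?I" by simp
      then show ?thesis by (rule LIMSEQ_imp_Suc)
    qed
    ultimately show ?case by blast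
  qed
  then show ?thesis using part1 by blast
qed

end
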